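(* Let $d\ge 2$ and let $H=SD<\mathrm{GL}(d,\mathbb{R})$ be a shearlet dilation group. Let $\psi\in L^2(\mathbb{R}^d)$ be of the form $$\mathcal{F}\psi(\tau,\tau v)=\mathcal{F}\psi_1(\tau)\,\mathcal{F}\psi_2(v)\qquad\text{for a.e. }(\tau,v)\in\mathbb{R}\times\mathbb{R}^{d-1},$$ with $\psi_2\in L^2(\mathbb{R}^{d-1})$ and $\psi_1\in L^2(\mathbb{R})$ satisfying $$\int_{\mathbb{R}}|\tau|^{d-1}|\mathcal{F}\psi_1(\tau)|^2\,d\tau<+\infty,\qquad 0<\int_{\mathbb{R}}\frac{|\mathcal{F}\psi_1(\tau)|^2}{|\tau|}\,d\tau<+\infty,\qquad \int_{\mathbb{R}}|\tau|^{2(d-1)}|\mathcal{F}\psi_1(\tau)|^2\,d\tau<+\infty.$$ Let $\phi_2=\mathcal{F}\psi_2\in L^2(\mathbb{R}^{d-1})$ and let $\chi_1\in L^2(\mathbb{R})$ be defined by $\mathcal{F}\chi_1(\tau)=|\tau|^{d-1}\mathcal{F}\psi_1(\tau)$. Then for all $f\in L^1(\mathbb{R}^d)\cap L^2(\mathbb{R}^d)$ and all $(b,s,a)\in\mathbb{R}^d\times\mathbb{R}^{d-1}\times\mathbb{R}^\times$, $$\mathcal{S}_\psi f(b,s,a)=|a|^{-\frac{d-1}{2}}\,\mathcal{V}_{\phi_2}\Big(v\mapsto\mathcal{W}_{\chi_1}\big(\mathcal{R}^{\rm aff}f(v,\cdot)\big)(n(v)\cdot b,a)\Big)(s,a).$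$
   Context: Notation: $\mathbb{R}^\times=\mathbb{R}\setminus\{0\}$; ${}^tA$ is the transpose; $\mathrm{T}(m,\mathbb{R})$ is the group of unipotent upper triangular $m\times m$ real matrices; vectors are column vectors; $x\cdot y$ is the Euclidean scalar product; $\langle\cdot,\cdot\rangle$ is the $L^2$ scalar product (linear in the first entry); $\mathcal{F}f(\xi)=\int f(x)e^{-2\pi i\xi\cdot x}\,dx$ is the Fourier transform. Shearlet dilation group: a subgroup $H=SD$ of $\mathrm{GL}(d,\mathbb{R})$ where (i) $S$ is a Lie subgroup of $\mathrm{T}(d,\mathbb{R})$ consisting of the matrices $\begin{bmatrix}1&-{}^ts\\0&B(s)\end{bmatrix}$, $s\in\mathbb{R}^{d-1}$, with $B:\mathbb{R}^{d-1}\to \mathrm{T}(d-1,\mathbb{R})$ a smooth map; (ii) $D$ is the group of diagonal matrices $a\begin{bmatrix}1&0\\0&\Lambda(a)\end{bmatrix}$, $a\in\mathbb{R}^\times$, where $\Lambda(a)=\mathrm{diag}(|a|^{\lambda_1},\dots,|a|^{\lambda_{d-1}})$ for a fixed $(\lambda_1,\dots,\lambda_{d-1})\in\mathbb{R}^{d-1}$. Put $\lambda_D=\lambda_1+\dots+\lambda_{d-1}$. The elements of $H$ are $h_{s,a}=a\begin{bmatrix}1&-{}^ts\Lambda(a)\\0&B(s)\Lambda(a)\end{bmatrix}$, $(s,a)\in\mathbb{R}^{d-1}\times\mathbb{R}^\times$. Representations and transforms: $S_{b,s,a}f(x)=|a|^{-\frac{d+\lambda_D}{2}}f(h_{s,a}^{-1}(x-b))$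 on $L^2(\mathbb{R}^d)$ and $\mathcal{S}_\psi f(b,s,a)=\langle f,S_{b,s,a}\psi\rangle$ (shearlet transform). $W_{\beta,a}g(x)=|a|^{-1/2}g(\frac{x-\beta}{a})$ on $L^2(\mathbb{R})$ and $\mathcal{W}_{\chi}g(\beta,a)=\langle g,W_{\beta,a}\chi\rangle$ (wavelet transform). $V_{s,a}g(v)=|a|^{\frac{\lambda_D}{2}}g(\Lambda(a)({}^tB(s)v-s))$ on $L^2(\mathbb{R}^{d-1})$ and $\mathcal{V}_{\phi}g(s,a)=\langle g,V_{s,a}\phi\rangle$. For $v\in\mathbb{R}^{d-1}$, $n(v)=(1,v)\in\mathbb{R}^d$. Affine Radon transform: for $f\in L^1(\mathbb{R}^d)$, $\mathcal{R}^{\rm aff}f(v,t)=\int_{\mathbb{R}^{d-1}}f(t-v\cdot y,y)\,dy$, $(v,t)\in\mathbb{R}^{d-1}\times\mathbb{R}$ (for every $v$, defined for almost every $t$). For $f\in L^1(\mathbb{R}^d)\cap L^2(\mathbb{R}^d)$, $\mathcal{R}^{\rm aff}f(v,\cdot)\in L^2(\mathbb{R})$ for almost every $v$. *)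

theory Defs
  imports
    "HOL-Analysis.Analysis"
    "HOL-Library.Option_ord"
    "HOL-Algebra.Group"
begin

text \<open>
  \<open>\<real>\<^sup>d\<^sup>-\<^sup>1\<close> is \<^typ>\<open>real ^ 'n\<close> and \<open>\<real>\<^sup>d\<close> is \<^typ>\<open>real ^ 'n option\<close>, so that \<open>d - 1 = CARD('n)\<close> and
  \<open>d = CARD('n option) \<ge> 2\<close>. The index \<^term>\<open>None\<close> is the first coordinate; it lies below all
  \<^term>\<open>Some i\<close>.
\<close>

definition square_integrable :: "('a::euclidean_space \<Rightarrow> complex) \<Rightarrow> bool" where
  "square_integrable f \<longleftrightarrow>
     f \<in> borel_measurable lborel \<and> integrable lborel (\<lambda>x. (cmod (f x))\<^sup>2)"

definition l2_inner :: "('a::euclidean_space \<Rightarrow> complex) \<Rightarrow> ('a \<Rightarrow> complex) \<Rightarrow> complex" where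
  "l2_inner f g = (LINT x|lborel. f x * cnj (g x))"

definition l2_tendsto :: "(nat \<Rightarrow> 'a::euclidean_space \<Rightarrow> complex) \<Rightarrow> ('a \<Rightarrow> complex) \<Rightarrow> bool" where
  "l2_tendsto g f \<longleftrightarrow> (\<lambda>k. \<integral>\<^sup>+x. ennreal ((cmod (g k x - f x))\<^sup>2) \<partial>lborel) \<longlonglongrightarrow> 0"

definition fourier_integral :: "('a::euclidean_space \<Rightarrow> complex) \<Rightarrow> 'a \<Rightarrow> complex" where
  "fourier_integral f \<xi> = (LINT x|lborel. f x * cis (- 2 * pi * (\<xi> \<bullet> x)))"

text \<open>
  The extension of \<^const>\<open>fourier_integral\<close> from \<open>L\<^sup>1 \<inter> L\<^sup>2\<close> to \<open>L\<^sup>2\<close> by continuity. Elements of \<open>L\<^sup>2\<close> are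
  represented by functions, so \<open>fourier f\<close> is an unspecified representative of an
  almost-everywhere class.
\<close>

definition is_fourier_transform ::
  "('a::euclidean_space \<Rightarrow> complex) \<Rightarrow> ('a \<Rightarrow> complex) \<Rightarrow> bool" where
  "is_fourier_transform f F \<longleftrightarrow>
     square_integrable F \<and>
     (\<exists>g. (\<forall>k. integrable lborel (g k) \<and> square_integrable (g k)) \<and>
          l2_tendsto g f \<and> l2_tendsto (\<lambda>k. fourier_integral (g k)) F)"

definition fourier :: "('a::euclidean_space \<Rightarrow> complex) \<Rightarrow> 'a \<Rightarrow> complex" where
  "fourier f = (SOME F. is_fourier_transform f F)"

definition GL_group :: "(real ^ 'm ^ 'm) monoid" where
  "GL_group = \<lparr>carrier = {A. invertible A}, monoid.mult = (**), one = mat 1\<rparr>"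

definition unipotent_upper_triangular :: "(real ^ ('m::{finite,linorder}) ^ ('m::{finite,linorder})) set" where
  "unipotent_upper_triangular =
     {A. (\<forall>i. A $ i $ i = 1) \<and> (\<forall>i j. j < i \<longrightarrow> A $ i $ j = 0)}"

primrec times_cont_differentiable ::
  "nat \<Rightarrow> ('a::real_normed_vector \<Rightarrow> 'b::real_normed_vector) \<Rightarrow> bool" where
  "times_cont_differentiable 0 f \<longleftrightarrow> continuous_on UNIV f"
| "times_cont_differentiable (Suc k) f \<longleftrightarrow>
     f differentiable_on UNIV \<and>
     (\<forall>v. times_cont_differentiable k (\<lambda>x. frechet_derivative f (at x) v))"

definition smooth_map :: "('a::real_normed_vector \<Rightarrow> 'b::real_normed_vector) \<Rightarrow> bool" where
  "smooth_map f \<longleftrightarrow> (\<forall>k. times_cont_differentiable k f)"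

definition vcons :: "real \<Rightarrow> real ^ 'n \<Rightarrow> real ^ 'n option" where
  "vcons t y = (\<chi> i. case i of None \<Rightarrow> t | Some j \<Rightarrow> y $ j)"

text \<open>The block matrix with rows \<open>(1, r)\<close> and \<open>(0, M)\<close>.\<close>

definition block_matrix :: "real ^ 'n \<Rightarrow> real ^ 'n ^ 'n \<Rightarrow> real ^ 'n option ^ 'n option" where
  "block_matrix r M = (\<chi> i. case i of None \<Rightarrow> vcons 1 r | Some k \<Rightarrow> vcons 0 (M $ k))"

definition Lambda_matrix :: "real ^ 'n \<Rightarrow> real \<Rightarrow> real ^ 'n ^ 'n" where
  "Lambda_matrix lam a = (\<chi> i j. if i = j then \<bar>a\<bar> powr (lam $ i) else 0)"

definition lambda_D :: "real ^ 'n \<Rightarrow> real" where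
  "lambda_D lam = (\<Sum>i\<in>UNIV. lam $ i)"

definition shear_group ::
  "(real ^ 'n \<Rightarrow> real ^ 'n ^ 'n) \<Rightarrow> (real ^ 'n option ^ 'n option) set" where
  "shear_group B = range (\<lambda>s. block_matrix (- s) (B s))"

definition diagonal_group :: "real ^ 'n \<Rightarrow> (real ^ 'n option ^ 'n option) set" where
  "diagonal_group lam = (\<lambda>a. a *\<^sub>R block_matrix 0 (Lambda_matrix lam a)) ` {a. a \<noteq> 0}"

text \<open>
  The shear group is the image of the graph of the smooth map \<open>B\<close> under a linear embedding, hence
  a closed submanifold: a subgroup of this form is automatically a Lie subgroup.
\<close>

definition shearlet_dilation_group ::
  "(real ^ ('n::{finite,linorder}) \<Rightarrow> real ^ ('n::{finite,linorder}) ^ ('n::{finite,linorder})) \<Rightarrow>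
     real ^ ('n::{finite,linorder}) \<Rightarrow>
     (real ^ ('n::{finite,linorder}) option ^ ('n::{finite,linorder}) option) set \<Rightarrow> bool" where
  "shearlet_dilation_group B lam H \<longleftrightarrow>
     smooth_map B \<and> range B \<subseteq> unipotent_upper_triangular \<and>
     shear_group B \<subseteq> unipotent_upper_triangular \<and> subgroup (shear_group B) GL_group \<and>
     H = {X ** Y | X Y. X \<in> shear_group B \<and> Y \<in> diagonal_group lam} \<and>
     subgroup H GL_group"

definition shearlet_matrix ::
  "(real ^ 'n \<Rightarrow> real ^ 'n ^ 'n) \<Rightarrow> real ^ 'n \<Rightarrow> real ^ 'n \<Rightarrow> real \<Rightarrow>
     real ^ 'n option ^ 'n option" where
  "shearlet_matrix B lam s a =
     a *\<^sub>R block_matrix (- (s v* Lambda_matrix lam a)) (B s ** Lambda_matrix lam a)"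

lemma shearlet_matrix_eq:
  "shearlet_matrix B lam s a =
     block_matrix (- s) (B s) ** (a *\<^sub>R block_matrix 0 (Lambda_matrix lam a))"
proof -
  have U: "(UNIV :: 'a option set) = insert None (range Some)"
    by (auto simp: UNIV_option_conv)
  have S: "(\<Sum>k\<in>UNIV. g k) = g None + (\<Sum>k\<in>UNIV. g (Some k))" for g :: "'a option \<Rightarrow> real"
    unfolding U by (subst sum.insert) (auto simp: sum.reindex)
  show ?thesis
    by (simp add: vec_eq_iff shearlet_matrix_def block_matrix_def vcons_def matrix_matrix_mult_def
        vector_matrix_mult_def S sum_distrib_left sum_negf ac_simps split: option.split)
qed

definition shearlet_rep ::
  "(real ^ 'n \<Rightarrow> real ^ 'n ^ 'n) \<Rightarrow> real ^ 'n \<Rightarrow> real ^ 'n option \<Rightarrow> real ^ 'n \<Rightarrow> real \<Rightarrow>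
     (real ^ 'n option \<Rightarrow> complex) \<Rightarrow> real ^ 'n option \<Rightarrow> complex" where
  "shearlet_rep B lam b s a f x =
     of_real (\<bar>a\<bar> powr (- (real CARD('n option) + lambda_D lam) / 2)) *
       f (matrix_inv (shearlet_matrix B lam s a) *v (x - b))"

definition shearlet_transform ::
  "(real ^ 'n \<Rightarrow> real ^ 'n ^ 'n) \<Rightarrow> real ^ 'n \<Rightarrow> (real ^ 'n option \<Rightarrow> complex) \<Rightarrow>
     (real ^ 'n option \<Rightarrow> complex) \<Rightarrow> real ^ 'n option \<Rightarrow> real ^ 'n \<Rightarrow> real \<Rightarrow> complex" where
  "shearlet_transform B lam \<psi> f b s a = l2_inner f (shearlet_rep B lam b s a \<psi>)"

definition wavelet_rep :: "real \<Rightarrow> real \<Rightarrow> (real \<Rightarrow> complex) \<Rightarrow> real \<Rightarrow> complex" where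
  "wavelet_rep \<beta> a g x = of_real (\<bar>a\<bar> powr (- 1 / 2)) * g ((x - \<beta>) / a)"

definition wavelet_transform ::
  "(real \<Rightarrow> complex) \<Rightarrow> (real \<Rightarrow> complex) \<Rightarrow> real \<Rightarrow> real \<Rightarrow> complex" where
  "wavelet_transform chi g \<beta> a = l2_inner g (wavelet_rep \<beta> a chi)"

definition V_rep ::
  "(real ^ 'n \<Rightarrow> real ^ 'n ^ 'n) \<Rightarrow> real ^ 'n \<Rightarrow> real ^ 'n \<Rightarrow> real \<Rightarrow>
     (real ^ 'n \<Rightarrow> complex) \<Rightarrow> real ^ 'n \<Rightarrow> complex" where
  "V_rep B lam s a g v =
     of_real (\<bar>a\<bar> powr (lambda_D lam / 2)) *
       g (Lambda_matrix lam a *v (transpose (B s) *v v - s))"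

definition V_transform ::
  "(real ^ 'n \<Rightarrow> real ^ 'n ^ 'n) \<Rightarrow> real ^ 'n \<Rightarrow> (real ^ 'n \<Rightarrow> complex) \<Rightarrow>
     (real ^ 'n \<Rightarrow> complex) \<Rightarrow> real ^ 'n \<Rightarrow> real \<Rightarrow> complex" where
  "V_transform B lam \<phi> g s a = l2_inner g (V_rep B lam s a \<phi>)"

definition affine_radon ::
  "(real ^ 'n option \<Rightarrow> complex) \<Rightarrow> real ^ 'n \<Rightarrow> real \<Rightarrow> complex" where
  "affine_radon f v t = (LINT y|lborel. f (vcons (t - v \<bullet> y) y))"

end

theory Submission
  imports Defs "HOL-Probability.Characteristic_Functions"
begin

text \<open>
  By Parseval's identity the shearlet transform is an integral of \<open>\<F>f\<close> against the conjugate of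
  \<open>\<F>\<psi>(\<^sup>th\<xi>)\<close>. In the coordinates \<open>\<xi> = (\<tau>, \<tau>v)\<close>, with Jacobian \<open>\<bar>\<tau>\<bar>\<^sup>d\<^sup>-\<^sup>1\<close>, the matrix \<open>\<^sup>th\<close> acts as
  \<open>(\<tau>, v) \<mapsto> (a\<tau>, \<Lambda>(a)(\<^sup>tB(s)v - s))\<close>, so \<open>\<F>\<psi>\<close> factorises; the Jacobian turns \<open>\<F>\<psi>\<^sub>1\<close> into
  \<open>\<F>\<chi>\<^sub>1\<close>. The inner integral over \<open>\<tau>\<close> is a wavelet transform, again by Parseval, because
  \<open>\<tau> \<mapsto> \<F>f(\<tau>, \<tau>v)\<close> is the Fourier transform of \<open>affine_radon f v\<close>.

  Plancherel's theorem is obtained in the form \<open>\<parallel>\<F>f\<parallel>\<^sub>2 = \<parallel>f\<parallel>\<^sub>2\<close> in \<open>[0, \<infinity>]\<close> for all \<open>f \<in> L\<^sup>1\<close>. It thus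
  also shows that the slices \<open>affine_radon f v\<close> are square integrable for almost every \<open>v\<close>. Its proof
  multiplies by a wide Gaussian, which turns the inverse transform into convolution with a narrow one.
\<close>

section \<open>Maps scaling Lebesgue measure and the Fourier integral\<close>

text \<open>The two functions enter asymmetrically. For \<open>f\<close> in L1 the Fourier integral
  is defined at every point, so it can be restricted to a null set such as the line of all (\<tau>,
  \<tau>v). For \<open>\<psi>\<close> there is only \<open>fourier \<psi>\<close>, an arbitrary
  representative, so its factorisation fails on some null set. That set has to be transported by the
  transposed matrix and then cut into null sets of \<tau> for almost every v. Explicit transforms of
  the translated and dilated \<open>\<psi>\<close> and \<open>\<chi>\<^sub>1\<close> can then be
  inserted without comparing representatives. The Jacobian of the matrix turns the normalisation
  |a|^(-(d + lambda_D)/2) into |a|^((d + lambda_D)/2). Of this, |a|^(d-1) completes |\<tau>|^(d-1)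
  to |a\<tau>|^(d-1), the wavelet takes |a|^(1/2) and the representation V takes |a|^(lambda_D/2).
  What remains is the constant |a|^(-(d-1)/2).\<close>

text \<open>\<open>J\<close> is the factor in \<integral>F = J \<integral>F \<circ> T, the absolute
  determinant for linear \<open>T\<close>. The encoding as an identity of measures makes one fact
  yield nonnegative integrals, Bochner integrals and null sets.\<close>

definition scales_lborel :: "('a::euclidean_space \<Rightarrow> 'a) \<Rightarrow> real \<Rightarrow> bool" where
  "scales_lborel T J \<longleftrightarrow> T \<in> borel \<rightarrow>\<^sub>M borel \<and> J > 0 \<and>
     lborel = density (distr lborel borel T) (\<lambda>_. ennreal J)"

lemma scales_lborelD:
  assumes "scales_lborel T J"
  shows "T \<in> borel \<rightarrow>\<^sub>M borel" "J > 0" "lborel = density (distr lborel borel T) (\<lambda>_. ennreal J)"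
  using assms by (auto simp: scales_lborel_def)

lemma scales_lborel_nn_integral:
  fixes T :: "'a::euclidean_space \<Rightarrow> 'a"
  assumes "scales_lborel T J" and [measurable]: "F \<in> borel_measurable borel"
  shows "(\<integral>\<^sup>+x. F x \<partial>lborel) = ennreal J * (\<integral>\<^sup>+x. F (T x) \<partial>lborel)"
proof -
  note [measurable] = scales_lborelD(1)[OF assms(1)]
  have "(\<integral>\<^sup>+x. F x \<partial>lborel) = (\<integral>\<^sup>+x. F x \<partial>density (distr lborel borel T) (\<lambda>_. ennreal J))"
    using scales_lborelD(3)[OF assms(1)] by simp
  also have "\<dots> = ennreal J * (\<integral>\<^sup>+x. F (T x) \<partial>lborel)"
    by (simp add: nn_integral_density nn_integral_distr nn_integral_cmult)
  finally show ?thesis .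
qed

lemma scales_lborelI:
  fixes T :: "'a::euclidean_space \<Rightarrow> 'a"
  assumes [measurable]: "T \<in> borel \<rightarrow>\<^sub>M borel" and J: "J > 0"
    and "\<And>A. A \<in> sets borel \<Longrightarrow> emeasure lborel A = ennreal J * emeasure lborel (T -` A)"
  shows "scales_lborel T J"
  unfolding scales_lborel_def
proof (intro conjI measure_eqI)
  fix A :: "'a set" assume "A \<in> sets lborel"
  then have [measurable]: "A \<in> sets borel" by simp
  show "emeasure lborel A = emeasure (density (distr lborel borel T) (\<lambda>_. ennreal J)) A"
    by (simp add: assms(3) emeasure_density nn_integral_cmult_indicator emeasure_distr)
qed (use assms in auto)

lemma scales_lborel_comp:
  assumes T: "scales_lborel T J" and U: "scales_lborel U K"
  shows "scales_lborel (\<lambda>x. T (U x)) (J * K)"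
proof -
  note [measurable] = scales_lborelD(1)[OF T] scales_lborelD(1)[OF U]
  have J: "J > 0" "K > 0" using scales_lborelD(2) T U by auto
  show ?thesis
  proof (rule scales_lborelI)
    fix A :: "'a set" assume [measurable]: "A \<in> sets borel"
    have "emeasure lborel A = (\<integral>\<^sup>+x. indicator A x \<partial>lborel)" by simp
    also have "\<dots> = ennreal J * (\<integral>\<^sup>+x. indicator A (T x) \<partial>lborel)"
      by (rule scales_lborel_nn_integral[OF T]) simp
    also have "\<dots> = ennreal J * (ennreal K * (\<integral>\<^sup>+x. indicator A (T (U x)) \<partial>lborel))"
      by (subst scales_lborel_nn_integral[OF U]) simp_all
    also have "(\<integral>\<^sup>+x. indicator A (T (U x)) \<partial>lborel) = (\<integral>\<^sup>+x. indicator ((\<lambda>x. T (U x)) -` A) x \<partial>lborel)"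
      by (simp add: indicator_def)
    also have "\<dots> = emeasure lborel ((\<lambda>x. T (U x)) -` A)"
      by (rule nn_integral_indicator) (use measurable_sets[of "\<lambda>x. T (U x)" borel borel A] in simp)
    finally show "emeasure lborel A = ennreal (J * K) * emeasure lborel ((\<lambda>x. T (U x)) -` A)"
      using J by (simp add: ennreal_mult mult.assoc)
  qed (use J in auto)
qed

lemma scales_lborel_affine:
  fixes t :: "'a::euclidean_space"
  assumes "c \<noteq> 0"
  shows "scales_lborel (\<lambda>x. t + c *\<^sub>R x) (\<bar>c\<bar> ^ DIM('a))"
  unfolding scales_lborel_def using assms lborel_affine[OF assms, of t] by simp

lemma scales_lborel_translate: "scales_lborel (\<lambda>x. x - z) 1" for z :: "'a::euclidean_space"
  using scales_lborel_affine[of 1 "- z"] by simp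

lemma scales_lborel_reflect: "scales_lborel (\<lambda>x. z - x) 1" for z :: "'a::euclidean_space"
  using scales_lborel_affine[of "-1" z] by simp

lemma scales_lborel_integrable_iff:
  fixes f :: "'a::euclidean_space \<Rightarrow> 'b::{banach, second_countable_topology}"
  assumes T: "scales_lborel T J" and [measurable]: "f \<in> borel_measurable borel"
  shows "integrable lborel (\<lambda>x. f (T x)) \<longleftrightarrow> integrable lborel f"
proof -
  note [measurable] = scales_lborelD(1)[OF T]
  have "ennreal J * (\<integral>\<^sup>+x. ennreal (norm (f (T x))) \<partial>lborel) = (\<integral>\<^sup>+x. ennreal (norm (f x)) \<partial>lborel)"
    by (rule scales_lborel_nn_integral[OF T, symmetric]) simp
  then have "(\<integral>\<^sup>+x. ennreal (norm (f (T x))) \<partial>lborel) < \<infinity> \<longleftrightarrow> (\<integral>\<^sup>+x. ennreal (norm (f x)) \<partial>lborel) < \<infinity>"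
    using scales_lborelD(2)[OF T]
    by (cases "\<integral>\<^sup>+x. ennreal (norm (f (T x))) \<partial>lborel"; cases "\<integral>\<^sup>+x. ennreal (norm (f x)) \<partial>lborel")
      (simp_all add: ennreal_mult_top flip: ennreal_mult)
  then show ?thesis by (simp add: integrable_iff_bounded)
qed

lemma scales_lborel_integrable:
  fixes f :: "'a::euclidean_space \<Rightarrow> 'b::{banach, second_countable_topology}"
  assumes "scales_lborel T J" and "integrable lborel f"
  shows "integrable lborel (\<lambda>x. f (T x))"
  using scales_lborel_integrable_iff[OF assms(1), of f] assms(2) borel_measurable_integrable[OF assms(2)]
  by simp

lemma scales_lborel_integral:
  fixes f :: "'a::euclidean_space \<Rightarrow> 'b::{banach, second_countable_topology}"
  assumes T: "scales_lborel T J" and [measurable]: "f \<in> borel_measurable borel"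
  shows "(LINT x|lborel. f x) = J *\<^sub>R (LINT x|lborel. f (T x))"
proof -
  note [measurable] = scales_lborelD(1)[OF T]
  have "(LINT x|lborel. f x) = (LINT x|density (distr lborel borel T) (\<lambda>_. ennreal J). f x)"
    using scales_lborelD(3)[OF T] by simp
  also have "\<dots> = (LINT x|distr lborel borel T. J *\<^sub>R f x)"
    using scales_lborelD(2)[OF T] by (subst integral_density) auto
  also have "\<dots> = J *\<^sub>R (LINT x|lborel. f (T x))"
    by (simp add: integral_distr)
  finally show ?thesis .
qed

text \<open>A Borel null set \<open>N\<close> enclosing the exceptional set has a null preimage
  because \<open>J\<close> is positive. This moves the almost-everywhere factorisation of
  \<open>fourier \<psi>\<close> to new coordinates.\<close>

lemma scales_lborel_AE:
  fixes T :: "'a::euclidean_space \<Rightarrow> 'a"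
  assumes T: "scales_lborel T J" and "AE x in lborel. P x"
  shows "AE x in lborel. P (T x)"
proof -
  note [measurable] = scales_lborelD(1)[OF T]
  obtain N where N: "{x. \<not> P x} \<subseteq> N" "N \<in> null_sets lborel"
    using assms(2) by (auto simp: eventually_ae_filter)
  then have [measurable]: "N \<in> sets borel" by (auto simp: null_sets_def)
  have "(\<integral>\<^sup>+x. indicator N x \<partial>lborel) = ennreal J * (\<integral>\<^sup>+x. indicator N (T x) \<partial>lborel)"
    by (rule scales_lborel_nn_integral[OF T]) simp
  moreover have "(\<integral>\<^sup>+x. indicator N x \<partial>lborel) = 0" using N by (auto simp: null_sets_def)
  ultimately have "(\<integral>\<^sup>+x. indicator N (T x) \<partial>(lborel :: 'a measure)) = 0"
    using scales_lborelD(2)[OF T] by auto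
  then have "AE x in lborel. indicator N (T x) = (0::ennreal)"
    by (subst (asm) nn_integral_0_iff_AE) auto
  then show ?thesis
    by eventually_elim (use N in \<open>auto simp: indicator_def split: if_splits\<close>)
qed

section \<open>The Fourier integral on L1\<close>

lemma integrable_pair_mult:
  fixes f :: "'a::euclidean_space \<Rightarrow> 'c::{real_normed_field, banach, second_countable_topology}"
    and g :: "'b::euclidean_space \<Rightarrow> 'c"
  assumes f: "integrable lborel f" and g: "integrable lborel g"
  shows "integrable (lborel \<Otimes>\<^sub>M lborel) (\<lambda>(x, y). f x * g y)"
proof -
  have [measurable]: "f \<in> borel_measurable borel" "g \<in> borel_measurable borel"
    using f g by auto
  show ?thesis
    by (rule lborel_pair.Fubini_integrable) (use f g in \<open>auto simp: norm_mult\<close>)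
qed

lemma cis_measurable [measurable (raw)]:
  "f \<in> borel_measurable M \<Longrightarrow> (\<lambda>x. cis (f x)) \<in> borel_measurable M"
  by (rule borel_measurable_continuous_on[OF continuous_on_cis[OF continuous_on_id]])

lemma integrable_mult_cis:
  fixes f :: "'a \<Rightarrow> complex"
  assumes "integrable M f" "g \<in> borel_measurable M"
  shows "integrable M (\<lambda>x. f x * cis (g x))"
  by (rule Bochner_Integration.integrable_bound[OF assms(1)])
    (use assms in \<open>auto simp: norm_mult\<close>)

lemma fourier_integral_measurable [measurable]:
  fixes f :: "'a::euclidean_space \<Rightarrow> complex"
  assumes [measurable]: "f \<in> borel_measurable borel"
  shows "fourier_integral f \<in> borel_measurable borel"
proof -
  have "(\<lambda>\<xi>. LINT x|lborel. f x * cis (- 2 * pi * (\<xi> \<bullet> x))) \<in> borel_measurable borel"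
    by measurable
  then show ?thesis by (simp add: fourier_integral_def[abs_def])
qed

lemma fourier_integral_bound:
  fixes f :: "'a::euclidean_space \<Rightarrow> complex"
  assumes "integrable lborel f"
  shows "cmod (fourier_integral f \<xi>) \<le> (LINT x|lborel. cmod (f x))"
proof -
  have "cmod (fourier_integral f \<xi>) \<le> (LINT x|lborel. cmod (f x * cis (- 2 * pi * (\<xi> \<bullet> x))))"
    unfolding fourier_integral_def by (rule integral_norm_bound)
  then show ?thesis by (simp add: norm_mult)
qed

lemma fourier_integral_diff:
  fixes f :: "'a::euclidean_space \<Rightarrow> complex"
  assumes "integrable lborel f" "integrable lborel g"
  shows "fourier_integral (\<lambda>x. f x - g x) \<xi> = fourier_integral f \<xi> - fourier_integral g \<xi>"
  unfolding fourier_integral_def left_diff_distrib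
  by (intro Bochner_Integration.integral_diff integrable_mult_cis) (use assms in auto)

lemma fourier_integral_add:
  fixes f :: "'a::euclidean_space \<Rightarrow> complex"
  assumes "integrable lborel f" "integrable lborel g"
  shows "fourier_integral (\<lambda>x. f x + g x) \<xi> = fourier_integral f \<xi> + fourier_integral g \<xi>"
  unfolding fourier_integral_def distrib_right
  by (intro Bochner_Integration.integral_add integrable_mult_cis) (use assms in auto)

lemma fourier_integral_cmult:
  "fourier_integral (\<lambda>x. c * f x) \<xi> = c * fourier_integral f \<xi>"
  unfolding fourier_integral_def by (simp add: mult.assoc)

text \<open>Fubini for f(x) g(y) e^(-2 \<pi> i x \<cdot> y), whose modulus is that of the integrable
  f(x) g(y). With a modulated Gaussian for \<open>g\<close> it becomes a regularised inversion
  formula.\<close>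

lemma fourier_integral_multiplication:
  fixes f g :: "'a::euclidean_space \<Rightarrow> complex"
  assumes f: "integrable lborel f" and g: "integrable lborel g"
  shows "(LINT \<xi>|lborel. fourier_integral f \<xi> * g \<xi>) = (LINT x|lborel. f x * fourier_integral g x)"
proof -
  have [measurable]: "f \<in> borel_measurable borel" "g \<in> borel_measurable borel"
    using f g by auto
  have I: "integrable (lborel \<Otimes>\<^sub>M lborel) (\<lambda>(x, y). (f x * g y) * cis (- 2 * pi * (x \<bullet> y)))"
    using integrable_mult_cis[OF integrable_pair_mult[OF f g], of "\<lambda>(x, y). - 2 * pi * (x \<bullet> y)"]
    by (simp add: case_prod_unfold)
  have "(LINT \<xi>|lborel. fourier_integral f \<xi> * g \<xi>)
      = (LINT y|lborel. LINT x|lborel. (f x * g y) * cis (- 2 * pi * (x \<bullet> y)))"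
    unfolding fourier_integral_def integral_mult_left_zero[symmetric]
    by (simp add: inner_commute mult_ac)
  also have "\<dots> = (LINT x|lborel. LINT y|lborel. (f x * g y) * cis (- 2 * pi * (x \<bullet> y)))"
    by (rule lborel_pair.Fubini_integral[OF I])
  also have "\<dots> = (LINT x|lborel. f x * fourier_integral g x)"
    unfolding fourier_integral_def integral_mult_right_zero[symmetric]
    by (simp add: inner_commute mult_ac)
  finally show ?thesis .
qed

text \<open>Fatou's lemma. It serves to remove a Gaussian weight, to pass from mollified functions
  to \<open>f\<close>, and to let one index of an L2 Cauchy sequence tend to infinity.\<close>

lemma nn_integral_le_of_AE_tendsto:
  fixes u :: "nat \<Rightarrow> 'a \<Rightarrow> ennreal"
  assumes [measurable]: "\<And>k. u k \<in> borel_measurable M" "v \<in> borel_measurable M"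
    and lim: "AE x in M. (\<lambda>k. u k x) \<longlonglongrightarrow> v x"
    and le: "\<And>k. (\<integral>\<^sup>+x. u k x \<partial>M) \<le> C"
  shows "(\<integral>\<^sup>+x. v x \<partial>M) \<le> C"
proof -
  have "(\<integral>\<^sup>+x. v x \<partial>M) = (\<integral>\<^sup>+x. liminf (\<lambda>k. u k x) \<partial>M)"
    by (rule nn_integral_cong_AE) (use lim in \<open>eventually_elim, auto simp: lim_imp_Liminf\<close>)
  also have "\<dots> \<le> liminf (\<lambda>k. \<integral>\<^sup>+x. u k x \<partial>M)"
    by (rule nn_integral_liminf) simp
  also have "\<dots> \<le> C"
    using le by (intro Liminf_le always_eventually) auto
  finally show ?thesis .
qed

lemma cnj_measurable [measurable (raw)]:
  "f \<in> borel_measurable M \<Longrightarrow> (\<lambda>x. cnj (f x)) \<in> borel_measurable M"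
  by (rule borel_measurable_continuous_on[OF continuous_on_cnj[OF continuous_on_id]])

section \<open>Gaussians and their Fourier transforms\<close>

text \<open>The factor \<pi> makes \<open>gaussian 1\<close> its own Fourier transform, with
  integral 1. The parameter multiplies the argument, so a small \<open>\<sigma>\<close> means a wide
  Gaussian. The values are complex because the function is fed to
  \<open>fourier_integral\<close>.\<close>

definition gaussian :: "real \<Rightarrow> 'a::euclidean_space \<Rightarrow> complex" where
  "gaussian \<sigma> x = of_real (exp (- pi * (\<sigma> * norm x)\<^sup>2))"

lemma gaussian_measurable [measurable]: "gaussian \<sigma> \<in> borel_measurable borel"
  unfolding gaussian_def[abs_def] by measurable

lemma norm_gaussian: "cmod (gaussian \<sigma> x) = exp (- pi * (\<sigma> * norm x)\<^sup>2)"
  by (simp add: gaussian_def)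

text \<open>Both facts come from the standard normal distribution by the substitution x \<mapsto>
  sqrt(2 \<pi>) x; the second is its characteristic function.\<close>

lemma gaussian_1d:
  shows integrable_gaussian_1d: "integrable lborel (\<lambda>x::real. exp (- pi * x\<^sup>2))"
    and fourier_gaussian_1d:
      "(LINT x|lborel. of_real (exp (- pi * x\<^sup>2)) * cis (- 2 * pi * (t * x))) = of_real (exp (- pi * t\<^sup>2))"
proof -
  have eq: "std_normal_density (sqrt (2 * pi) * x) = exp (- pi * x\<^sup>2) / sqrt (2 * pi)" for x
    by (simp add: std_normal_density_def power_mult_distrib)
  have "integrable lborel std_normal_density"
    using integrable_std_normal_moment[of 0] by simp
  then have "integrable lborel (\<lambda>x. std_normal_density (0 + sqrt (2 * pi) * x))"
    by (rule lborel_integrable_real_affine) auto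
  then have "integrable lborel (\<lambda>x. exp (- pi * x\<^sup>2) / sqrt (2 * pi) * sqrt (2 * pi))"
    unfolding eq add_0 by (rule integrable_mult_left)
  then show "integrable lborel (\<lambda>x::real. exp (- pi * x\<^sup>2))"
    by simp
  \<comment> \<open>With this frequency, u sqrt(2 \<pi>) x = -2 \<pi> t x and u^2 / 2 = \<pi>
    t^2.\<close>
  define u where "u = - sqrt (2 * pi) * t"
  have "of_real (exp (- (u\<^sup>2) / 2)) = char std_normal_distribution u"
    by (simp add: char_std_normal_distribution)
  also have "\<dots> = (LINT x|lborel. std_normal_density x *\<^sub>R iexp (u * x))"
    unfolding char_def by (subst integral_density) auto
  also have "\<dots> = sqrt (2 * pi) *\<^sub>R (LINT x|lborel. std_normal_density (0 + sqrt (2 * pi) * x)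
      *\<^sub>R iexp (u * (0 + sqrt (2 * pi) * x)))"
    by (subst lborel_integral_real_affine[of "sqrt (2 * pi)" _ 0]) auto
  also have "\<dots> = (LINT x|lborel. of_real (exp (- pi * x\<^sup>2)) * cis (- 2 * pi * (t * x)))"
    unfolding integral_scaleR_right[symmetric]
  proof (rule Bochner_Integration.integral_cong[OF refl])
    fix x :: real
    have "u * (sqrt (2 * pi) * x) = - 2 * pi * (t * x)"
      using real_sqrt_mult_self[of "2 * pi"] by (simp add: u_def)
    then show "sqrt (2 * pi) *\<^sub>R (std_normal_density (0 + sqrt (2 * pi) * x) *\<^sub>R
         iexp (u * (0 + sqrt (2 * pi) * x))) = of_real (exp (- pi * x\<^sup>2)) * cis (- 2 * pi * (t * x))"
      using eq[of x] by (simp add: cis_conv_exp scaleR_conv_of_real)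
  qed
  finally show "(LINT x|lborel. of_real (exp (- pi * x\<^sup>2)) * cis (- 2 * pi * (t * x))) = of_real (exp (- pi * t\<^sup>2))"
    by (simp add: u_def power_mult_distrib)
qed

text \<open>Gaussian and character both factor over the coordinates, and \<open>lborel\<close> is
  the image of a product of one-dimensional Lebesgue measures, so the integral is a product of
  one-dimensional ones.\<close>

lemma gaussian_nd:
  fixes \<xi> :: "'a::euclidean_space"
  shows integrable_gaussian_1: "integrable lborel (gaussian 1 :: 'a \<Rightarrow> complex)"
    and fourier_gaussian_1: "fourier_integral (gaussian 1) \<xi> = gaussian 1 \<xi>"
proof -
  interpret P: product_sigma_finite "\<lambda>_::'a. lborel :: real measure" ..
  define g :: "'a \<Rightarrow> real \<Rightarrow> complex" where
    "g b x = of_real (exp (- pi * x\<^sup>2)) * cis (- 2 * pi * ((\<xi> \<bullet> b) * x))" for b x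
  have [measurable]: "g b \<in> borel_measurable borel" for b
    unfolding g_def[abs_def] by measurable
  have norm2: "(norm x)\<^sup>2 = (\<Sum>b\<in>Basis. (x \<bullet> b)\<^sup>2)" for x :: 'a
    by (subst euclidean_inner[of x x, folded power2_norm_eq_inner]) (simp add: power2_eq_square)
  have prod: "gaussian 1 x * cis (- 2 * pi * (\<xi> \<bullet> x)) = (\<Prod>b\<in>Basis. g b (x \<bullet> b))" for x :: 'a
    unfolding g_def gaussian_def norm2 power_mult_distrib euclidean_inner[of \<xi> x] cis_conv_exp
      exp_of_real[symmetric] exp_add[symmetric] exp_sum[OF finite_Basis, symmetric]
    by (simp add: sum_distrib_left sum_negf sum_subtractf sum.distrib ac_simps)
  have norm1: "of_real (exp (- pi * (norm \<xi>)\<^sup>2)) = (\<Prod>b\<in>Basis. complex_of_real (exp (- pi * (\<xi> \<bullet> b)\<^sup>2)))"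
    unfolding norm2 exp_of_real[symmetric] exp_sum[OF finite_Basis, symmetric]
    by (simp add: sum_distrib_left sum_negf)
  have g_int: "integrable lborel (g b)" for b
    unfolding g_def
    by (intro integrable_mult_cis integrable_of_real integrable_gaussian_1d) auto
  have meas: "(\<lambda>f. \<Sum>b\<in>Basis. f b *\<^sub>R b) \<in> (\<Pi>\<^sub>M b\<in>Basis. lborel) \<rightarrow>\<^sub>M (borel :: 'a measure)"
    by measurable
  have "integrable lborel (\<lambda>x::'a. \<Prod>b\<in>Basis. g b (x \<bullet> b))"
    unfolding lborel_eq[where 'a='a]
    by (subst integrable_distr_eq[OF meas])
      (use P.product_integrable_prod[OF finite_Basis, of g] g_int in \<open>auto cong: prod.cong\<close>)
  \<comment> \<open>The character has modulus 1 and drops out on taking norms, so integrability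
    passes to the Gaussian itself.\<close>
  then have "integrable lborel (\<lambda>x::'a. norm (gaussian 1 x * cis (- 2 * pi * (\<xi> \<bullet> x))))"
    unfolding prod by (rule integrable_norm)
  then have "integrable lborel (\<lambda>x::'a. norm (gaussian 1 x))"
    by (simp add: norm_mult)
  then show "integrable lborel (gaussian 1 :: 'a \<Rightarrow> complex)"
    by (subst (asm) integrable_norm_iff) auto
  have "fourier_integral (gaussian 1) \<xi> = integral\<^sup>L (lborel :: 'a measure) (\<lambda>x. \<Prod>b\<in>Basis. g b (x \<bullet> b))"
    by (simp only: fourier_integral_def prod)
  also have "\<dots> = integral\<^sup>L (Pi\<^sub>M (Basis::'a set) (\<lambda>_. lborel)) (\<lambda>f. \<Prod>b\<in>Basis. g b (f b))"
    unfolding lborel_eq[where 'a='a]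
    by (subst integral_distr[OF meas]) (auto cong: prod.cong)
  also have "\<dots> = (\<Prod>b\<in>Basis. integral\<^sup>L lborel (g b))"
    by (rule P.product_integral_prod) (auto simp: g_int)
  also have "\<dots> = gaussian 1 \<xi>"
    unfolding g_def fourier_gaussian_1d gaussian_def using norm1 by simp
  finally show "fourier_integral (gaussian 1) \<xi> = gaussian 1 \<xi>" .
qed

lemma integrable_gaussian:
  assumes "\<sigma> > 0"
  shows "integrable lborel (gaussian \<sigma> :: 'a::euclidean_space \<Rightarrow> complex)"
  using scales_lborel_integrable[OF scales_lborel_affine[of \<sigma> "0::'a"] integrable_gaussian_1] assms
  by (simp add: gaussian_def[abs_def])

lemma fourier_gaussian:
  fixes \<xi> :: "'a::euclidean_space"
  assumes "\<sigma> > 0"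
  shows "fourier_integral (gaussian \<sigma>) \<xi> = of_real (1 / \<sigma> ^ DIM('a)) * gaussian (1 / \<sigma>) \<xi>"
proof -
  have "fourier_integral (gaussian 1) ((1 / \<sigma>) *\<^sub>R \<xi>)
      = (\<bar>\<sigma>\<bar> ^ DIM('a)) *\<^sub>R (LINT x|lborel. gaussian 1 (0 + \<sigma> *\<^sub>R x) * cis (- 2 * pi * (((1 / \<sigma>) *\<^sub>R \<xi>) \<bullet> (0 + \<sigma> *\<^sub>R x))))"
    unfolding fourier_integral_def
    by (rule scales_lborel_integral[OF scales_lborel_affine[of \<sigma> "0::'a"]]) (use assms in auto)
  also have "\<dots> = (\<bar>\<sigma>\<bar> ^ DIM('a)) *\<^sub>R fourier_integral (gaussian \<sigma>) \<xi>"
    using assms by (simp add: fourier_integral_def gaussian_def)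
  finally show ?thesis
    using assms by (simp add: fourier_gaussian_1 gaussian_def scaleR_conv_of_real field_simps)
qed

lemma integral_gaussian_1: "(LINT x|lborel. cmod (gaussian 1 (x :: 'a::euclidean_space))) = 1"
proof -
  have "(LINT x|lborel. gaussian 1 (x :: 'a)) = 1"
    using fourier_gaussian_1[of "0::'a"] by (simp add: fourier_integral_def gaussian_def)
  then have "complex_of_real (LINT x|lborel. cmod (gaussian 1 (x :: 'a))) = 1"
    by (simp add: norm_gaussian gaussian_def flip: integral_complex_of_real)
  then show ?thesis by simp
qed

lemma nn_integral_gaussian_1: "(\<integral>\<^sup>+x. ennreal (cmod (gaussian 1 (x :: 'a::euclidean_space))) \<partial>lborel) = 1"
  using integrable_gaussian_1 by (subst nn_integral_eq_integral) (auto simp: integral_gaussian_1)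

section \<open>Gaussian mollification and the first half of Plancherel's theorem\<close>

text \<open>Convolution with the Gaussian of width \<open>\<sigma>\<close> and integral 1, written
  after the substitution y = x - \<sigma>w. The kernel stays fixed and \<open>\<sigma>\<close>
  enters only through translations of \<open>f\<close>.\<close>

definition mollify :: "real \<Rightarrow> ('a::euclidean_space \<Rightarrow> complex) \<Rightarrow> 'a \<Rightarrow> complex" where
  "mollify \<sigma> f x = (LINT w|lborel. f (x - \<sigma> *\<^sub>R w) * gaussian 1 w)"

lemma mollify_measurable [measurable]:
  assumes [measurable]: "f \<in> borel_measurable borel"
  shows "mollify \<sigma> f \<in> borel_measurable borel"
  unfolding mollify_def[abs_def] by measurable

text \<open>The multiplication formula for \<open>f\<close> and the modulated Gaussian
  \<open>e\<close>, whose Fourier integral is a narrow normalised Gaussian centred at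
  \<open>x\<close>.\<close>

lemma mollify_eq_inverse_fourier:
  fixes f :: "'a::euclidean_space \<Rightarrow> complex"
  assumes f: "integrable lborel f" and \<sigma>: "\<sigma> > 0"
  shows "mollify \<sigma> f x = (LINT \<xi>|lborel. fourier_integral f \<xi> * (gaussian \<sigma> \<xi> * cis (2 * pi * (\<xi> \<bullet> x))))"
proof -
  have [measurable]: "f \<in> borel_measurable borel" using f by auto
  define e where "e \<xi> = gaussian \<sigma> \<xi> * cis (2 * pi * (\<xi> \<bullet> x))" for \<xi>
  have e: "integrable lborel e"
    unfolding e_def by (rule integrable_mult_cis[OF integrable_gaussian[OF \<sigma>]]) simp
  have Fe: "fourier_integral e y = of_real (1 / \<sigma> ^ DIM('a)) * gaussian (1 / \<sigma>) (y - x)" for y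
  proof -
    have "fourier_integral e y = fourier_integral (gaussian \<sigma>) (y - x)"
      unfolding fourier_integral_def e_def
      by (intro Bochner_Integration.integral_cong refl)
        (simp add: mult.assoc cis_mult inner_diff_left inner_commute algebra_simps)
    then show ?thesis by (simp add: fourier_gaussian[OF \<sigma>])
  qed
  \<comment> \<open>The Jacobian of y = x - \<sigma>w cancels the height of the narrow
    Gaussian.\<close>
  have sc: "scales_lborel (\<lambda>w. x - \<sigma> *\<^sub>R w) (\<sigma> ^ DIM('a))"
    using scales_lborel_affine[of "- \<sigma>" x] \<sigma> by simp
  have "(LINT \<xi>|lborel. fourier_integral f \<xi> * e \<xi>) = (LINT y|lborel. f y * fourier_integral e y)"
    by (rule fourier_integral_multiplication[OF f e])
  also have "\<dots> = (LINT y|lborel. f y * (of_real (1 / \<sigma> ^ DIM('a)) * gaussian (1 / \<sigma>) (y - x)))"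
    by (simp add: Fe)
  also have "\<dots> = (\<sigma> ^ DIM('a)) *\<^sub>R (LINT w|lborel. f (x - \<sigma> *\<^sub>R w) *
      (of_real (1 / \<sigma> ^ DIM('a)) * gaussian (1 / \<sigma>) (x - \<sigma> *\<^sub>R w - x)))"
    by (rule scales_lborel_integral[OF sc]) simp
  also have "\<dots> = mollify \<sigma> f x"
    unfolding mollify_def integral_scaleR_right[symmetric] using \<sigma>
    by (intro Bochner_Integration.integral_cong refl) (simp add: gaussian_def scaleR_conv_of_real)
  finally show ?thesis by (simp add: e_def)
qed

text \<open>A non-integrable function has Bochner integral 0 by convention, so the bound can be
  applied before integrability is known.\<close>

lemma ennreal_norm_integral_le:
  fixes f :: "'a \<Rightarrow> 'b::{banach, second_countable_topology}"
  shows "ennreal (norm (integral\<^sup>L M f)) \<le> (\<integral>\<^sup>+x. ennreal (norm (f x)) \<partial>M)"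
  using integral_norm_bound_ennreal[of M f] not_integrable_integral_eq[of M f] by (cases "integrable M f") auto

text \<open>The multiplication formula for \<open>f\<close> and \<open>h\<close> turns the left side
  into the scalar product of \<open>f\<close> with its mollification. Then |f(x)| |f(x - \<sigma>w)|
  is at most the mean of the two squares, and translation invariance and the unit mass of the
  Gaussian give the bound. Computing in [0, \<infinity>] includes the case of an \<open>f\<close>
  outside L2.\<close>

lemma nn_integral_gaussian_fourier_le:
  fixes f :: "'a::euclidean_space \<Rightarrow> complex"
  assumes f: "integrable lborel f" and \<sigma>: "\<sigma> > 0"
  shows "(\<integral>\<^sup>+\<xi>. ennreal ((cmod (fourier_integral f \<xi>))\<^sup>2 * cmod (gaussian \<sigma> \<xi>)) \<partial>lborel)
    \<le> (\<integral>\<^sup>+x. ennreal ((cmod (f x))\<^sup>2) \<partial>lborel)"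
proof -
  have [measurable]: "f \<in> borel_measurable borel" using f by auto
  define h where "h \<xi> = cnj (fourier_integral f \<xi>) * gaussian \<sigma> \<xi>" for \<xi>
  \<comment> \<open>The Fourier integral of an L1 function is bounded by \<open>K\<close>, so
    \<open>h\<close> and the weighted square are dominated by multiples of the Gaussian.\<close>
  define K where "K = (LINT x|lborel. cmod (f x))"
  have K: "cmod (fourier_integral f \<xi>) \<le> K" for \<xi>
    unfolding K_def by (rule fourier_integral_bound[OF f])
  have K0: "0 \<le> K" unfolding K_def by simp
  have h: "integrable lborel h"
  proof (rule Bochner_Integration.integrable_bound)
    show "integrable lborel (\<lambda>\<xi>. of_real K * gaussian \<sigma> \<xi>)"
      by (intro integrable_mult_right integrable_gaussian \<sigma>)
    show "AE \<xi> in lborel. norm (h \<xi>) \<le> norm (of_real K * gaussian \<sigma> \<xi>)"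
      using K K0 by (auto simp: h_def norm_mult intro!: mult_right_mono)
  qed (simp add: h_def[abs_def])
  have Fh: "fourier_integral h x = cnj (mollify \<sigma> f x)" for x
  proof -
    have "fourier_integral h x
        = (LINT \<xi>|lborel. cnj (fourier_integral f \<xi> * (gaussian \<sigma> \<xi> * cis (2 * pi * (\<xi> \<bullet> x)))))"
      unfolding fourier_integral_def[of h] h_def
      by (intro Bochner_Integration.integral_cong refl)
        (simp add: gaussian_def cis_cnj inner_commute mult.assoc)
    also have "\<dots> = cnj (mollify \<sigma> f x)"
      unfolding mollify_eq_inverse_fourier[OF f \<sigma>] by (rule Bochner_Integration.integral_cnj)
    finally show ?thesis .
  qed
  have int: "integrable lborel (\<lambda>\<xi>. (cmod (fourier_integral f \<xi>))\<^sup>2 * cmod (gaussian \<sigma> \<xi>))"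
  proof (rule Bochner_Integration.integrable_bound)
    show "integrable lborel (\<lambda>\<xi>. K\<^sup>2 * cmod (gaussian \<sigma> \<xi>))"
      by (intro integrable_mult_right integrable_norm integrable_gaussian \<sigma>)
    show "AE \<xi> in lborel. norm ((cmod (fourier_integral f \<xi>))\<^sup>2 * cmod (gaussian \<sigma> \<xi>))
        \<le> norm (K\<^sup>2 * cmod (gaussian \<sigma> \<xi>))"
      using K K0 by (auto simp: abs_mult intro!: mult_right_mono power_mono)
  qed simp
  have "complex_of_real (LINT \<xi>|lborel. (cmod (fourier_integral f \<xi>))\<^sup>2 * cmod (gaussian \<sigma> \<xi>))
      = (LINT \<xi>|lborel. fourier_integral f \<xi> * h \<xi>)"
    unfolding integral_complex_of_real[symmetric] h_def
    by (intro Bochner_Integration.integral_cong refl)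
      (simp add: complex_norm_square norm_gaussian gaussian_def del: of_real_power)
  also have "\<dots> = (LINT x|lborel. f x * cnj (mollify \<sigma> f x))"
    by (simp add: fourier_integral_multiplication[OF f h] Fh)
  finally have eq: "complex_of_real (LINT \<xi>|lborel. (cmod (fourier_integral f \<xi>))\<^sup>2 * cmod (gaussian \<sigma> \<xi>))
      = (LINT x|lborel. f x * cnj (mollify \<sigma> f x))" .
  have "(\<integral>\<^sup>+\<xi>. ennreal ((cmod (fourier_integral f \<xi>))\<^sup>2 * cmod (gaussian \<sigma> \<xi>)) \<partial>lborel)
      = ennreal (LINT \<xi>|lborel. (cmod (fourier_integral f \<xi>))\<^sup>2 * cmod (gaussian \<sigma> \<xi>))"
    by (rule nn_integral_eq_integral[OF int]) simp
  also have "\<dots> = ennreal (cmod (LINT x|lborel. f x * cnj (mollify \<sigma> f x)))"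
    unfolding eq[symmetric] norm_of_real by (simp add: integral_nonneg_AE)
  also have "\<dots> \<le> (\<integral>\<^sup>+x. ennreal (cmod (f x * cnj (mollify \<sigma> f x))) \<partial>lborel)"
    by (rule ennreal_norm_integral_le)
  also have "\<dots> \<le> (\<integral>\<^sup>+x. \<integral>\<^sup>+w. ennreal (1 / 2) * (ennreal ((cmod (f x))\<^sup>2) + ennreal ((cmod (f (x - \<sigma> *\<^sub>R w)))\<^sup>2))
      * ennreal (cmod (gaussian 1 w)) \<partial>lborel \<partial>lborel)"
  proof (rule nn_integral_mono)
    fix x
    have "ennreal (cmod (f x * cnj (mollify \<sigma> f x))) = ennreal (cmod (LINT w|lborel. f x * (f (x - \<sigma> *\<^sub>R w) * gaussian 1 w)))"
      by (simp add: mollify_def norm_mult)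
    also have "\<dots> \<le> (\<integral>\<^sup>+w. ennreal (cmod (f x * (f (x - \<sigma> *\<^sub>R w) * gaussian 1 w))) \<partial>lborel)"
      by (rule ennreal_norm_integral_le)
    also have "\<dots> \<le> (\<integral>\<^sup>+w. ennreal (1 / 2) * (ennreal ((cmod (f x))\<^sup>2) + ennreal ((cmod (f (x - \<sigma> *\<^sub>R w)))\<^sup>2))
      * ennreal (cmod (gaussian 1 w)) \<partial>lborel)"
    proof (rule nn_integral_mono)
      fix w
      have "cmod (f x) * cmod (f (x - \<sigma> *\<^sub>R w)) \<le> ((cmod (f x))\<^sup>2 + (cmod (f (x - \<sigma> *\<^sub>R w)))\<^sup>2) / 2"
        using sum_squares_bound[of "cmod (f x)" "cmod (f (x - \<sigma> *\<^sub>R w))"] by simp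
      then have "cmod (f x * (f (x - \<sigma> *\<^sub>R w) * gaussian 1 w)) \<le>
          ((cmod (f x))\<^sup>2 + (cmod (f (x - \<sigma> *\<^sub>R w)))\<^sup>2) / 2 * cmod (gaussian 1 w)"
        unfolding norm_mult mult.assoc[symmetric] by (rule mult_right_mono) simp
      then have "ennreal (cmod (f x * (f (x - \<sigma> *\<^sub>R w) * gaussian 1 w))) \<le>
          ennreal (((cmod (f x))\<^sup>2 + (cmod (f (x - \<sigma> *\<^sub>R w)))\<^sup>2) / 2 * cmod (gaussian 1 w))"
        by (rule ennreal_leI)
      then show "ennreal (cmod (f x * (f (x - \<sigma> *\<^sub>R w) * gaussian 1 w))) \<le>
          ennreal (1 / 2) * (ennreal ((cmod (f x))\<^sup>2) + ennreal ((cmod (f (x - \<sigma> *\<^sub>R w)))\<^sup>2)) * ennreal (cmod (gaussian 1 w))"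
        by (simp only: ennreal_plus[symmetric] ennreal_mult[symmetric] zero_le_power2 norm_ge_zero
            add_nonneg_nonneg zero_le_divide_1_iff zero_le_numeral mult_nonneg_nonneg)
          (simp add: mult_ac)
    qed
    finally show "ennreal (cmod (f x * cnj (mollify \<sigma> f x))) \<le> (\<integral>\<^sup>+w. ennreal (1 / 2) * (ennreal ((cmod (f x))\<^sup>2) + ennreal ((cmod (f (x - \<sigma> *\<^sub>R w)))\<^sup>2))
      * ennreal (cmod (gaussian 1 w)) \<partial>lborel)" .
  qed
  \<comment> \<open>With \<open>w\<close> outside, the two squares have the same integral over
    \<open>x\<close>.\<close>
  also have "\<dots> = (\<integral>\<^sup>+w. \<integral>\<^sup>+x. ennreal (1 / 2) * (ennreal ((cmod (f x))\<^sup>2) + ennreal ((cmod (f (x - \<sigma> *\<^sub>R w)))\<^sup>2))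
      * ennreal (cmod (gaussian 1 w)) \<partial>lborel \<partial>lborel)"
    by (rule lborel_pair.Fubini') simp
  also have "\<dots> = (\<integral>\<^sup>+w. (\<integral>\<^sup>+x. ennreal ((cmod (f x))\<^sup>2) \<partial>lborel) * ennreal (cmod (gaussian 1 (w::'a))) \<partial>lborel)"
  proof (rule nn_integral_cong)
    fix w :: 'a
    have half: "ennreal (1 / 2) * (X + X) = X" for X
    proof -
      have "ennreal (1 / 2) * 2 = ennreal (1 / 2 * 2)"
        by (subst ennreal_mult) auto
      then show ?thesis by (simp add: mult.assoc[symmetric] mult_2[symmetric])
    qed
    have "(\<integral>\<^sup>+x. ennreal ((cmod (f x))\<^sup>2) \<partial>lborel) = (\<integral>\<^sup>+x. ennreal ((cmod (f (x - \<sigma> *\<^sub>R w)))\<^sup>2) \<partial>lborel)"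
      by (subst scales_lborel_nn_integral[OF scales_lborel_translate[of "\<sigma> *\<^sub>R w"]]) simp_all
    then show "(\<integral>\<^sup>+x. ennreal (1 / 2) * (ennreal ((cmod (f x))\<^sup>2) + ennreal ((cmod (f (x - \<sigma> *\<^sub>R w)))\<^sup>2))
      * ennreal (cmod (gaussian 1 w)) \<partial>lborel) = (\<integral>\<^sup>+x. ennreal ((cmod (f x))\<^sup>2) \<partial>lborel) * ennreal (cmod (gaussian 1 w))"
      using half by (simp add: nn_integral_multc nn_integral_cmult nn_integral_add)
  qed
  also have "\<dots> = (\<integral>\<^sup>+x. ennreal ((cmod (f x))\<^sup>2) \<partial>lborel)"
    by (simp add: nn_integral_cmult nn_integral_gaussian_1)
  finally show ?thesis .
qed

text \<open>As the Gaussian gets wider, the weight tends to 1 at every point and Fatou removes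
  it.\<close>

lemma nn_integral_fourier_le:
  fixes f :: "'a::euclidean_space \<Rightarrow> complex"
  assumes f: "integrable lborel f"
  shows "(\<integral>\<^sup>+\<xi>. ennreal ((cmod (fourier_integral f \<xi>))\<^sup>2) \<partial>lborel) \<le> (\<integral>\<^sup>+x. ennreal ((cmod (f x))\<^sup>2) \<partial>lborel)"
proof (rule nn_integral_le_of_AE_tendsto)
  have [measurable]: "f \<in> borel_measurable borel" using f by auto
  let ?u = "\<lambda>k \<xi>. ennreal ((cmod (fourier_integral f \<xi>))\<^sup>2 * cmod (gaussian (1 / real (Suc k)) \<xi>))"
  show "?u k \<in> borel_measurable lborel" for k by simp
  show "(\<lambda>\<xi>. ennreal ((cmod (fourier_integral f \<xi>))\<^sup>2)) \<in> borel_measurable lborel" by simp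
  show "(\<integral>\<^sup>+\<xi>. ?u k \<xi> \<partial>lborel) \<le> (\<integral>\<^sup>+x. ennreal ((cmod (f x))\<^sup>2) \<partial>lborel)" for k
    by (rule nn_integral_gaussian_fourier_le[OF f]) simp
  have "(\<lambda>k. 1 / real (Suc k)) \<longlonglongrightarrow> 0"
    using LIMSEQ_inverse_real_of_nat by (simp add: inverse_eq_divide)
  then have "(\<lambda>k. cmod (gaussian (1 / real (Suc k)) \<xi>)) \<longlonglongrightarrow> exp (- pi * (0 * norm \<xi>)\<^sup>2)" for \<xi> :: 'a
    unfolding norm_gaussian by (intro tendsto_intros)
  then have "(\<lambda>k. ?u k \<xi>) \<longlonglongrightarrow> ennreal ((cmod (fourier_integral f \<xi>))\<^sup>2 * exp (- pi * (0 * norm \<xi>)\<^sup>2))" for \<xi>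
    by (intro tendsto_ennrealI tendsto_mult tendsto_const)
  then show "AE \<xi> in lborel. (\<lambda>k. ?u k \<xi>) \<longlonglongrightarrow> ennreal ((cmod (fourier_integral f \<xi>))\<^sup>2)"
    by simp
qed

section \<open>Continuity of translations in L1 and the second half of Plancherel's theorem\<close>

text \<open>An argument with three terms of size e/3: the translation difference of \<open>f\<close>
  is compared with that of \<open>g\<close>, and the two error terms have equal norm by translation
  invariance. It serves both the approximation by open sets and the limit case of the induction
  below.\<close>

lemma L1_translation_approx:
  fixes f :: "'a::euclidean_space \<Rightarrow> complex"
  assumes f: "integrable lborel f"
    and approx: "\<And>e. e > 0 \<Longrightarrow> \<exists>g. integrable lborel g \<and> (LINT x|lborel. norm (f x - g x)) < e \<and>
      (\<lambda>k. LINT x|lborel. norm (g (x - z k) - g x)) \<longlonglongrightarrow> 0"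
  shows "(\<lambda>k. LINT x|lborel. norm (f (x - z k) - f x)) \<longlonglongrightarrow> 0"
proof (rule tendstoI)
  fix e :: real assume "e > 0"
  then obtain g where g: "integrable lborel g" "(LINT x|lborel. norm (f x - g x)) < e / 3"
    "(\<lambda>k. LINT x|lborel. norm (g (x - z k) - g x)) \<longlonglongrightarrow> 0"
    using approx[of "e / 3"] by auto
  have tr: "integrable lborel (\<lambda>x. h (x - z k))" if "integrable lborel h" for h :: "'a \<Rightarrow> complex" and k
    using scales_lborel_integrable[OF scales_lborel_translate that] .
  have "\<forall>\<^sub>F k in sequentially. (LINT x|lborel. norm (g (x - z k) - g x)) < e / 3"
    using order_tendstoD(2)[OF g(3), of "e / 3"] \<open>e > 0\<close> by auto
  then show "\<forall>\<^sub>F k in sequentially. dist (LINT x|lborel. norm (f (x - z k) - f x)) 0 < e"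
  proof eventually_elim
    case (elim k)
    have meas [measurable]: "f \<in> borel_measurable borel" "g \<in> borel_measurable borel" using f g(1) by auto
    have tri: "norm (p - q) \<le> norm (p - p') + norm (p' - q') + norm (q - q')" for p q p' q' :: complex
      using norm_triangle_ineq[of "p - p'" "p' - q'"] norm_triangle_ineq4[of "p - q'" "q - q'"] by simp
    have "(LINT x|lborel. norm (f (x - z k) - f x)) \<le>
        (LINT x|lborel. norm (f (x - z k) - g (x - z k)) + norm (g (x - z k) - g x) + norm (f x - g x))"
      by (rule integral_mono)
        (use f g(1) tr in \<open>auto intro!: integrable_norm Bochner_Integration.integrable_diff
           Bochner_Integration.integrable_add tri\<close>)
    also have "\<dots> = (LINT x|lborel. norm (f (x - z k) - g (x - z k))) +
        (LINT x|lborel. norm (g (x - z k) - g x)) + (LINT x|lborel. norm (f x - g x))"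
      using f g(1) tr by (simp add: Bochner_Integration.integral_add)
    also have "(LINT x|lborel. norm (f (x - z k) - g (x - z k))) = (LINT x|lborel. norm (f x - g x))"
      using scales_lborel_integral[OF scales_lborel_translate[of "z k"], of "\<lambda>x. norm (f x - g x)"] by simp
    finally show ?case using g(2) elim by simp
  qed
qed

text \<open>
  The difference of the two indicators has integral zero, so it suffices to bound its negative part,
  which is dominated by the indicator of \<open>U\<close> and tends to zero pointwise because \<open>U\<close> is open.
\<close>

lemma L1_translation_open:
  fixes U :: "'a::euclidean_space set" and c :: complex
  assumes U: "open U" "emeasure lborel U < \<infinity>" and z: "z \<longlonglongrightarrow> 0"
  shows "(\<lambda>k. LINT x|lborel. norm (indicator U (x - z k) *\<^sub>R c - indicator U x *\<^sub>R c)) \<longlonglongrightarrow> 0"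
proof -
  have [measurable]: "U \<in> sets borel" using U by auto
  let ?I = "indicator U :: 'a \<Rightarrow> real"
  have I: "integrable lborel ?I" using U by (simp add: integrable_indicator_iff)
  have It: "integrable lborel (\<lambda>x. ?I (x - z k))" for k
    using scales_lborel_integrable[OF scales_lborel_translate I] .
  have Ieq: "(LINT x|lborel. ?I (x - z k)) = (LINT x|lborel. ?I x)" for k
    using scales_lborel_integral[OF scales_lborel_translate[of "z k"], of ?I] by simp
  let ?p = "\<lambda>k x. max 0 (?I x - ?I (x - z k))"
  have p: "integrable lborel (?p k)" for k
    by (rule Bochner_Integration.integrable_bound[OF I]) (auto simp: indicator_def)
  have "(\<lambda>k. LINT x|lborel. ?p k x) \<longlonglongrightarrow> (LINT x|lborel. (0::real) * ?I x)"
  proof (rule integral_dominated_convergence[where w = ?I])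
    show "AE x in lborel. (\<lambda>k. ?p k x) \<longlonglongrightarrow> 0 * ?I x"
    proof (rule AE_I2)
      fix x
      show "(\<lambda>k. ?p k x) \<longlonglongrightarrow> 0 * ?I x"
      proof (cases "x \<in> U")
        case True
        have "(\<lambda>k. x - z k) \<longlonglongrightarrow> x - 0" by (intro tendsto_intros z)
        then have "\<forall>\<^sub>F k in sequentially. x - z k \<in> U"
          using True U(1) by (simp add: topological_tendstoD)
        then have "\<forall>\<^sub>F k in sequentially. ?p k x = 0"
          by eventually_elim (use True in simp)
        then show ?thesis by (simp add: tendsto_eventually)
      qed (simp add: indicator_def)
    qed
  qed (use I in \<open>auto simp: indicator_def\<close>)
  then have lim: "(\<lambda>k. 2 * (LINT x|lborel. ?p k x) * norm c) \<longlonglongrightarrow> 2 * 0 * norm c"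
    by (intro tendsto_intros) simp
  have "(LINT x|lborel. norm (indicator U (x - z k) *\<^sub>R c - indicator U x *\<^sub>R c))
      = 2 * (LINT x|lborel. ?p k x) * norm c" for k
  proof -
    have "(LINT x|lborel. norm (indicator U (x - z k) *\<^sub>R c - indicator U x *\<^sub>R c))
      = (LINT x|lborel. (2 * ?p k x + (?I (x - z k) - ?I x)) * norm c)"
      by (intro Bochner_Integration.integral_cong refl) (auto simp: indicator_def)
    also have "\<dots> = (2 * (LINT x|lborel. ?p k x) + ((LINT x|lborel. ?I (x - z k)) - (LINT x|lborel. ?I x))) * norm c"
      using p[of k] I It[of k] by simp
    finally show ?thesis by (simp add: Ieq)
  qed
  then show ?thesis using lim by simp
qed

text \<open>Induction over integrable functions. An indicator is approximated in L1 from outside by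
  the indicator of an open set, where convergence is already known.\<close>

lemma L1_translation_tendsto:
  fixes f :: "'a::euclidean_space \<Rightarrow> complex"
  assumes f: "integrable lborel f" and z: "z \<longlonglongrightarrow> 0"
  shows "(\<lambda>k. LINT x|lborel. norm (f (x - z k) - f x)) \<longlonglongrightarrow> 0"
  using f
proof (induction rule: integrable_induct)
  case (base A c)
  then have [measurable]: "A \<in> sets borel" by simp
  have A: "emeasure lborel A < \<infinity>" using base by simp
  have cA: "integrable lborel (\<lambda>x. indicator A x *\<^sub>R c)" using A by (simp add: integrable_indicator_iff)
  show ?case
  proof (rule L1_translation_approx[OF cA])
    fix e :: real assume e: "e > 0"
    \<comment> \<open>The summand 1 covers c = 0.\<close>
    then have "e / (norm c + 1) > 0" by (simp add: add_nonneg_pos)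
    then obtain U where U: "open U" "A \<subseteq> U" "emeasure lborel (U - A) < e / (norm c + 1)"
      using outer_regular_lborel[of A "e / (norm c + 1)"] by auto
    have [measurable]: "U \<in> sets borel" using U by auto
    have "emeasure lborel U \<le> emeasure lborel A + emeasure lborel (U - A)"
      using emeasure_subadditive[of A lborel "U - A"] U(2) by (simp add: Un_absorb1)
    also have "\<dots> < \<infinity>" using A U(3) by (simp add: less_top order_less_trans[OF _ ennreal_less_top])
    finally have finU: "emeasure lborel U < \<infinity>" .
    have fd: "emeasure lborel (U - A) < \<infinity>" using U(3) ennreal_less_top order_less_trans by fastforce
    have "(LINT x|lborel. norm (indicator A x *\<^sub>R c - indicator U x *\<^sub>R c)) = (LINT x|lborel. indicator (U - A) x * norm c)"
      using U(2) by (intro Bochner_Integration.integral_cong refl) (auto simp: indicator_def)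
    also have "\<dots> = measure lborel (U - A) * norm c" by simp
    also have "\<dots> \<le> measure lborel (U - A) * (norm c + 1)" by (simp add: mult_left_mono)
    also have "\<dots> < e"
      using U(3) fd by (simp add: emeasure_eq_ennreal_measure pos_less_divide_eq add_nonneg_pos ennreal_less_iff)
    finally show "\<exists>g. integrable lborel g \<and> (LINT x|lborel. norm (indicator A x *\<^sub>R c - g x)) < e \<and>
      (\<lambda>k. LINT x|lborel. norm (g (x - z k) - g x)) \<longlonglongrightarrow> 0"
      using L1_translation_open[OF U(1) finU z, of c] finU
      by (intro exI[of _ "\<lambda>x. indicator U x *\<^sub>R c"]) (auto simp: integrable_indicator_iff)
  qed
next
  case (add f g)
  have tr: "integrable lborel (\<lambda>x. h (x - z k))" if "integrable lborel h" for h :: "'a \<Rightarrow> complex" and k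
    using scales_lborel_integrable[OF scales_lborel_translate that] .
  have [measurable]: "f \<in> borel_measurable borel" "g \<in> borel_measurable borel" using add by auto
  show ?case
  proof (rule tendsto_sandwich[OF _ _ tendsto_const])
    show "(\<lambda>k. (LINT x|lborel. norm (f (x - z k) - f x)) + (LINT x|lborel. norm (g (x - z k) - g x))) \<longlonglongrightarrow> 0"
      using tendsto_add[OF add.IH] by simp
    have "(LINT x|lborel. norm (f (x - z k) + g (x - z k) - (f x + g x)))
       \<le> (LINT x|lborel. norm (f (x - z k) - f x) + norm (g (x - z k) - g x))" for k
      using add.hyps tr norm_diff_triangle_ineq
      by (intro integral_mono Bochner_Integration.integrable_add integrable_norm Bochner_Integration.integrable_diff)
        auto
    then show "\<forall>\<^sub>F k in sequentially. (LINT x|lborel. norm (f (x - z k) + g (x - z k) - (f x + g x)))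
       \<le> (LINT x|lborel. norm (f (x - z k) - f x)) + (LINT x|lborel. norm (g (x - z k) - g x))"
      using add.hyps tr by (auto simp: Bochner_Integration.integral_add)
  qed auto
next
  case (lim f s)
  show ?case
  proof (rule L1_translation_approx[OF lim.hyps(4)])
    fix e :: real assume e: "e > 0"
    have [measurable]: "f \<in> borel_measurable borel" "s i \<in> borel_measurable borel" for i
      using lim by auto
    have "(\<lambda>i. LINT x|lborel. norm (f x - s i x)) \<longlonglongrightarrow> (LINT x|lborel. norm (f x - f x))"
    \<comment> \<open>The induction provides |s i x| \<le> 2 |f x|, hence the dominating function 3
      |f|.\<close>
    proof (rule integral_dominated_convergence[where w = "\<lambda>x. 3 * norm (f x)"])
      show "AE x in lborel. (\<lambda>i. norm (f x - s i x)) \<longlonglongrightarrow> norm (f x - f x)"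
        using lim by (intro AE_I2 tendsto_intros) auto
      show "AE x in lborel. norm (norm (f x - s i x)) \<le> 3 * norm (f x)" for i
      proof (rule AE_I2)
        fix x
        have "norm (f x - s i x) \<le> norm (f x) + norm (s i x)" by (rule norm_triangle_ineq4)
        then show "norm (norm (f x - s i x)) \<le> 3 * norm (f x)" using lim.hyps(3)[of x i] by simp
      qed
    qed (use lim in auto)
    then have "\<forall>\<^sub>F i in sequentially. (LINT x|lborel. norm (f x - s i x)) < e"
      by (rule order_tendstoD(2)) (use e in simp)
    then obtain i where "(LINT x|lborel. norm (f x - s i x)) < e"
      by (auto simp: eventually_sequentially)
    then show "\<exists>g. integrable lborel g \<and> (LINT x|lborel. norm (f x - g x)) < e \<and>
      (\<lambda>k. LINT x|lborel. norm (g (x - z k) - g x)) \<longlonglongrightarrow> 0"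
      using lim.hyps(1) lim.IH by blast
  qed
qed

text \<open>By Minkowski's inequality the L1 distance of \<open>mollify s f\<close> from
  \<open>f\<close> is at most the Gaussian average of \<omega>(s w), where \<open>\<omega>\<close>
  is the L1 modulus of continuity of \<open>f\<close>. It is bounded by twice the L1 norm of
  \<open>f\<close> and tends to 0 at the origin, so dominated convergence applies.\<close>

lemma mollify_L1_tendsto:
  fixes f :: "'a::euclidean_space \<Rightarrow> complex"
  assumes f: "integrable lborel f" and \<sigma>: "\<sigma> \<longlonglongrightarrow> 0" "\<And>k. \<sigma> k > 0"
  shows "integrable lborel (mollify (\<sigma> k) f)"
    and "(\<lambda>k. LINT x|lborel. norm (mollify (\<sigma> k) f x - f x)) \<longlonglongrightarrow> 0"
proof -
  have [measurable]: "f \<in> borel_measurable borel" using f by auto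
  have tr: "integrable lborel (\<lambda>x. f (x - z))" for z
    using scales_lborel_integrable[OF scales_lborel_translate f] .
  define \<omega> where "\<omega> z = (LINT x|lborel. norm (f (x - z) - f x))" for z
  have [measurable]: "\<omega> \<in> borel_measurable borel"
    unfolding \<omega>_def[abs_def] by measurable
  have \<omega>0: "\<omega> z \<ge> 0" for z unfolding \<omega>_def by simp
  have \<omega>b: "\<omega> z \<le> 2 * (LINT x|lborel. norm (f x))" for z
  proof -
    have "\<omega> z \<le> (LINT x|lborel. norm (f (x - z)) + norm (f x))"
      unfolding \<omega>_def using tr[of z] f norm_triangle_ineq4
      by (intro integral_mono Bochner_Integration.integrable_add integrable_norm Bochner_Integration.integrable_diff) auto
    also have "\<dots> = (LINT x|lborel. norm (f (x - z))) + (LINT x|lborel. norm (f x))"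
      using tr[of z] f by (simp add: Bochner_Integration.integral_add)
    also have "(LINT x|lborel. norm (f (x - z))) = (LINT x|lborel. norm (f x))"
      using scales_lborel_integral[OF scales_lborel_translate[of z], of "\<lambda>x. norm (f x)"] by simp
    finally show ?thesis by simp
  qed
  define K where "K = 2 * (LINT x|lborel. norm (f x))"
  have K0: "K \<ge> 0" unfolding K_def by simp
  have gi: "integrable lborel (\<lambda>w::'a. cmod (gaussian 1 w))"
    using integrable_gaussian_1 by (rule integrable_norm)
  have \<omega>g: "integrable lborel (\<lambda>w. \<omega> (s *\<^sub>R w) * cmod (gaussian 1 w))" for s
  proof (rule Bochner_Integration.integrable_bound)
    show "integrable lborel (\<lambda>w::'a. K * cmod (gaussian 1 w))"
      by (intro integrable_mult_right gi)
    show "AE w in lborel. norm (\<omega> (s *\<^sub>R w) * cmod (gaussian 1 w)) \<le> norm (K * cmod (gaussian 1 w))"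
      using \<omega>0 \<omega>b K0 by (auto simp: abs_mult K_def intro!: mult_right_mono)
  qed simp
  have bound: "integrable lborel (mollify s f)"
    "(LINT x|lborel. norm (mollify s f x - f x)) \<le> (LINT w|lborel. \<omega> (s *\<^sub>R w) * cmod (gaussian 1 (w::'a)))" for s
  proof -
    \<comment> \<open>\<open>?C\<close> is the convolution integrand, \<open>?E\<close> averages the
      constant f(x), and \<open>?D\<close> is their difference. Integrability on the product is
      checked for \<open>?D\<close>, whose norm integrates over x to \<omega>(s w) times the
      Gaussian, and for \<open>?E\<close>; that of \<open>?C\<close> follows by addition.\<close>
    let ?C = "\<lambda>w x. f (x - s *\<^sub>R w) * gaussian 1 w"
    let ?E = "\<lambda>(w::'a) x. f x * gaussian 1 w"
    let ?D = "\<lambda>w x. (f (x - s *\<^sub>R w) - f x) * gaussian 1 w"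
    have D: "integrable (lborel \<Otimes>\<^sub>M lborel) (\<lambda>(w, x). ?D w x)"
    proof (rule lborel_pair.Fubini_integrable)
      show "integrable lborel (\<lambda>w. LINT x|lborel. norm (case (w, x) of (w, x) \<Rightarrow> ?D w x))"
        using \<omega>g[of s] by (simp add: norm_mult \<omega>_def)
      show "AE w in lborel. integrable lborel (\<lambda>x. case (w, x) of (w, x) \<Rightarrow> ?D w x)"
        using tr f by (intro AE_I2) auto
    qed (simp add: case_prod_unfold)
    have E: "integrable (lborel \<Otimes>\<^sub>M lborel) (\<lambda>(w, x). ?E w x)"
      using integrable_pair_mult[OF integrable_gaussian_1 f] by (simp add: mult.commute)
    have C: "integrable (lborel \<Otimes>\<^sub>M lborel) (\<lambda>(w, x). ?C w x)"
      using Bochner_Integration.integrable_add[OF D E] by (simp add: case_prod_unfold ring_distribs)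
    show "integrable lborel (mollify s f)"
      using lborel_pair.integrable_snd[OF C] by (simp add: mollify_def[abs_def])
    have E1: "(LINT w|lborel. ?E w x) = f x" for x
    proof -
      have "(LINT w|lborel. gaussian 1 (w :: 'a)) = 1"
        using fourier_gaussian_1[of "0::'a"] by (simp add: fourier_integral_def gaussian_def)
      then show ?thesis by simp
    qed
    \<comment> \<open>Fubini makes the convolution integrand integrable in \<open>w\<close> for
      almost every \<open>x\<close>, and there the integral splits.\<close>
    have "AE x in lborel. norm (mollify s f x - f x) = norm (LINT w|lborel. ?D w x)"
      using lborel_pair.AE_integrable_snd[OF C]
    proof eventually_elim
      case (elim x)
      have "integrable lborel (\<lambda>w::'a. ?E w x)" using integrable_gaussian_1 by (rule integrable_mult_right)
      then have "(LINT w|lborel. ?C w x - ?E w x) = (LINT w|lborel. ?C w x) - (LINT w|lborel. ?E w x)"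
        using elim by (intro Bochner_Integration.integral_diff)
      then show ?case by (simp only: mollify_def E1 left_diff_distrib)
    qed
    then have "(LINT x|lborel. norm (mollify s f x - f x)) = (LINT x|lborel. norm (LINT w|lborel. ?D w x))"
      by (intro integral_cong_AE) auto
    also have "\<dots> \<le> (LINT x|lborel. LINT w|lborel. norm (?D w x))"
    proof (intro integral_mono integral_norm_bound)
      show "integrable lborel (\<lambda>x. norm (LINT w|lborel. ?D w x))"
        using lborel_pair.integrable_snd[OF D] by (rule integrable_norm)
      have "integrable (lborel \<Otimes>\<^sub>M lborel) (\<lambda>(w, x). norm (?D w x))"
        using integrable_norm[OF D] by (simp add: case_prod_unfold)
      from lborel_pair.integrable_snd[OF this]
      show "integrable lborel (\<lambda>x. LINT w|lborel. norm (?D w x))" .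
    qed
    also have "\<dots> = (LINT w|lborel. LINT x|lborel. norm (?D w x))"
    proof (rule lborel_pair.Fubini_integral)
      show "integrable (lborel \<Otimes>\<^sub>M lborel) (\<lambda>(w, x). norm (?D w x))"
        using integrable_norm[OF D] by (simp add: case_prod_unfold)
    qed
    also have "\<dots> = (LINT w|lborel. \<omega> (s *\<^sub>R w) * cmod (gaussian 1 (w::'a)))"
      by (simp add: norm_mult \<omega>_def)
    finally show "(LINT x|lborel. norm (mollify s f x - f x)) \<le>
      (LINT w|lborel. \<omega> (s *\<^sub>R w) * cmod (gaussian 1 (w::'a)))" .
  qed
  show "integrable lborel (mollify (\<sigma> k) f)" by (rule bound)
  have lim: "(\<lambda>k. LINT w|lborel. \<omega> (\<sigma> k *\<^sub>R w) * cmod (gaussian 1 (w::'a))) \<longlonglongrightarrow> (LINT w|lborel. 0 * cmod (gaussian 1 (w::'a)))"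
  proof (rule integral_dominated_convergence[where w = "\<lambda>w. K * cmod (gaussian 1 w)"])
    show "integrable lborel (\<lambda>w::'a. K * cmod (gaussian 1 w))"
      by (intro integrable_mult_right gi)
    show "AE w in lborel. norm (\<omega> (\<sigma> k *\<^sub>R w) * cmod (gaussian 1 w)) \<le> K * cmod (gaussian 1 w)" for k
      using \<omega>0 \<omega>b K0 by (auto simp: abs_mult K_def intro!: mult_right_mono)
    show "AE w in lborel. (\<lambda>k. \<omega> (\<sigma> k *\<^sub>R w) * cmod (gaussian 1 w)) \<longlonglongrightarrow> 0 * cmod (gaussian 1 w)"
    proof (intro AE_I2 tendsto_mult tendsto_const)
      fix w :: 'a
      have "(\<lambda>k. \<sigma> k *\<^sub>R w) \<longlonglongrightarrow> 0 *\<^sub>R w" by (intro tendsto_intros \<sigma>)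
      then show "(\<lambda>k. \<omega> (\<sigma> k *\<^sub>R w)) \<longlonglongrightarrow> 0"
        unfolding \<omega>_def by (intro L1_translation_tendsto[OF f]) simp
    qed
  qed auto
  show "(\<lambda>k. LINT x|lborel. norm (mollify (\<sigma> k) f x - f x)) \<longlonglongrightarrow> 0"
    by (rule tendsto_sandwich[OF _ _ tendsto_const lim[simplified]]) (auto intro!: always_eventually bound)
qed

text \<open>Up to a reflection, \<open>mollify s f\<close> is the Fourier integral of
  \<open>h\<close>, the Fourier integral of \<open>f\<close> times a Gaussian. The inequality
  already proved, applied to \<open>h\<close>, bounds its square norm by the right side uniformly in
  \<open>s\<close>; then \<open>s\<close> tends to 0.\<close>

lemma nn_integral_le_fourier:
  fixes f :: "'a::euclidean_space \<Rightarrow> complex"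
  assumes f: "integrable lborel f"
  shows "(\<integral>\<^sup>+x. ennreal ((cmod (f x))\<^sup>2) \<partial>lborel) \<le> (\<integral>\<^sup>+\<xi>. ennreal ((cmod (fourier_integral f \<xi>))\<^sup>2) \<partial>lborel)"
proof -
  have [measurable]: "f \<in> borel_measurable borel" using f by auto
  define \<sigma> where "\<sigma> k = 1 / real (Suc k)" for k
  have \<sigma>: "\<sigma> \<longlonglongrightarrow> 0" "\<And>k. \<sigma> k > 0"
    using LIMSEQ_inverse_real_of_nat by (auto simp: inverse_eq_divide \<sigma>_def[abs_def])
  \<comment> \<open>Convergence in L1 gives convergence almost everywhere along a subsequence, which
    suffices for Fatou.\<close>
  obtain r where r: "AE x in lborel. (\<lambda>n. mollify (\<sigma> (r n)) f x - f x) \<longlonglongrightarrow> 0"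
    using tendsto_L1_AE_subseq[of lborel "\<lambda>k x. mollify (\<sigma> k) f x - f x"] f mollify_L1_tendsto[OF f \<sigma>]
    by auto
  show ?thesis
  proof (rule nn_integral_le_of_AE_tendsto)
    show "AE x in lborel. (\<lambda>n. ennreal ((cmod (mollify (\<sigma> (r n)) f x))\<^sup>2)) \<longlonglongrightarrow> ennreal ((cmod (f x))\<^sup>2)"
      using r by eventually_elim (auto intro!: tendsto_ennrealI tendsto_intros dest: Lim_transform_eventually simp: LIM_zero_iff)
    fix n
    define s where "s = \<sigma> (r n)"
    have s: "s > 0" using \<sigma> by (simp add: s_def)
    define h where "h \<xi> = fourier_integral f \<xi> * gaussian s \<xi>" for \<xi>
    have h: "integrable lborel h"
    proof (rule Bochner_Integration.integrable_bound)
      show "integrable lborel (\<lambda>\<xi>. of_real (LINT x|lborel. cmod (f x)) * gaussian s \<xi>)"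
        by (intro integrable_mult_right integrable_gaussian s)
      show "AE \<xi> in lborel. norm (h \<xi>) \<le> norm (of_real (LINT x|lborel. cmod (f x)) * gaussian s \<xi>)"
        using fourier_integral_bound[OF f] by (auto simp: h_def norm_mult intro!: mult_right_mono)
    qed (simp add: h_def[abs_def])
    have [measurable]: "h \<in> borel_measurable borel" using h by auto
    have m: "mollify s f x = fourier_integral h (- x)" for x
      by (simp add: mollify_eq_inverse_fourier[OF f s] fourier_integral_def[of h] h_def mult.assoc inner_commute)
    have "(\<integral>\<^sup>+x. ennreal ((cmod (mollify s f x))\<^sup>2) \<partial>lborel) = (\<integral>\<^sup>+x. ennreal ((cmod (fourier_integral h x))\<^sup>2) \<partial>lborel)"
      using scales_lborel_nn_integral[OF scales_lborel_reflect[of 0], of "\<lambda>x. ennreal ((cmod (fourier_integral h x))\<^sup>2)"]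
      by (simp add: m)
    also have "\<dots> \<le> (\<integral>\<^sup>+x. ennreal ((cmod (h x))\<^sup>2) \<partial>lborel)"
      by (rule nn_integral_fourier_le[OF h])
    also have "\<dots> \<le> (\<integral>\<^sup>+\<xi>. ennreal ((cmod (fourier_integral f \<xi>))\<^sup>2) \<partial>lborel)"
      by (intro nn_integral_mono ennreal_leI power_mono)
        (auto simp: h_def norm_mult norm_gaussian intro!: mult_left_le)
    finally show "(\<integral>\<^sup>+x. ennreal ((cmod (mollify (\<sigma> (r n)) f x))\<^sup>2) \<partial>lborel) \<le> (\<integral>\<^sup>+\<xi>. ennreal ((cmod (fourier_integral f \<xi>))\<^sup>2) \<partial>lborel)"
      by (simp add: s_def)
  qed auto
qed

theorem plancherel_L1:
  fixes f :: "'a::euclidean_space \<Rightarrow> complex"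
  assumes "integrable lborel f"
  shows "(\<integral>\<^sup>+\<xi>. ennreal ((cmod (fourier_integral f \<xi>))\<^sup>2) \<partial>lborel) = (\<integral>\<^sup>+x. ennreal ((cmod (f x))\<^sup>2) \<partial>lborel)"
  by (intro antisym nn_integral_fourier_le nn_integral_le_fourier assms)

section \<open>Square-integrable functions and Parseval's identity\<close>

lemma square_integrable_iff:
  "square_integrable f \<longleftrightarrow> f \<in> borel_measurable borel \<and> (\<integral>\<^sup>+x. ennreal ((cmod (f x))\<^sup>2) \<partial>lborel) < \<infinity>"
  by (auto simp: square_integrable_def integrable_iff_bounded)

lemma square_integrable_measurable [measurable_dest]:
  "square_integrable f \<Longrightarrow> f \<in> borel_measurable borel"
  by (simp add: square_integrable_def)

lemma norm_add_square_le: "(norm (a + b))\<^sup>2 \<le> 2 * (norm a)\<^sup>2 + 2 * (norm (b :: 'a::real_normed_vector))\<^sup>2"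
proof -
  have "(norm (a + b))\<^sup>2 \<le> (norm a + norm b)\<^sup>2"
    by (intro power_mono norm_triangle_ineq norm_ge_zero)
  then show ?thesis using sum_squares_bound[of "norm a" "norm b"] by (simp add: power2_sum)
qed

lemma nn_integral_add_square_le:
  assumes [measurable]: "f \<in> borel_measurable M" "g \<in> borel_measurable M"
  shows "(\<integral>\<^sup>+x. ennreal ((cmod (f x + g x))\<^sup>2) \<partial>M)
    \<le> 2 * (\<integral>\<^sup>+x. ennreal ((cmod (f x))\<^sup>2) \<partial>M) + 2 * (\<integral>\<^sup>+x. ennreal ((cmod (g x))\<^sup>2) \<partial>M)"
proof -
  have "(\<integral>\<^sup>+x. ennreal ((cmod (f x + g x))\<^sup>2) \<partial>M)
      \<le> (\<integral>\<^sup>+x. 2 * ennreal ((cmod (f x))\<^sup>2) + 2 * ennreal ((cmod (g x))\<^sup>2) \<partial>M)"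
  proof (rule nn_integral_mono)
    fix x
    have "ennreal ((cmod (f x + g x))\<^sup>2) \<le> ennreal (2 * (cmod (f x))\<^sup>2 + 2 * (cmod (g x))\<^sup>2)"
      by (rule ennreal_leI[OF norm_add_square_le])
    then show "ennreal ((cmod (f x + g x))\<^sup>2) \<le> 2 * ennreal ((cmod (f x))\<^sup>2) + 2 * ennreal ((cmod (g x))\<^sup>2)"
      by (simp add: ennreal_plus ennreal_mult)
  qed
  then show ?thesis by (simp add: nn_integral_add nn_integral_cmult)
qed

lemma square_integrable_add:
  assumes "square_integrable f" "square_integrable g"
  shows "square_integrable (\<lambda>x. f x + g x)"
proof -
  note [measurable] = square_integrable_measurable[OF assms(1)] square_integrable_measurable[OF assms(2)]
  have "(\<integral>\<^sup>+x. ennreal ((cmod (f x + g x))\<^sup>2) \<partial>lborel)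
    \<le> 2 * (\<integral>\<^sup>+x. ennreal ((cmod (f x))\<^sup>2) \<partial>lborel) + 2 * (\<integral>\<^sup>+x. ennreal ((cmod (g x))\<^sup>2) \<partial>lborel)"
    by (rule nn_integral_add_square_le) simp_all
  also have "\<dots> < \<infinity>" using assms by (auto simp: square_integrable_iff ennreal_mult_less_top)
  finally show ?thesis by (simp add: square_integrable_iff)
qed

lemma square_integrable_cmult:
  assumes "square_integrable f"
  shows "square_integrable (\<lambda>x. c * f x)"
  using assms unfolding square_integrable_def
  by (auto simp: norm_mult power_mult_distrib intro!: integrable_mult_right)

lemma square_integrable_diff:
  assumes "square_integrable f" "square_integrable g"
  shows "square_integrable (\<lambda>x. f x - g x)"
  using square_integrable_add[OF assms(1) square_integrable_cmult[OF assms(2), of "-1"]] by simp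

lemma square_integrable_cnj: "square_integrable f \<Longrightarrow> square_integrable (\<lambda>x. cnj (f x))"
  by (auto simp: square_integrable_def)

lemma integrable_square_mult:
  assumes "square_integrable f" "square_integrable g"
  shows "integrable lborel (\<lambda>x. f x * g x)"
proof (rule Bochner_Integration.integrable_bound)
  note [measurable] = square_integrable_measurable[OF assms(1)] square_integrable_measurable[OF assms(2)]
  show "integrable lborel (\<lambda>x. (cmod (f x))\<^sup>2 + (cmod (g x))\<^sup>2)"
    using assms by (auto simp: square_integrable_def)
  have "cmod (f x * g x) \<le> (cmod (f x))\<^sup>2 + (cmod (g x))\<^sup>2" for x
    using sum_squares_bound[of "cmod (f x)" "cmod (g x)"] mult_nonneg_nonneg[OF norm_ge_zero norm_ge_zero, of "f x" "g x"]
    unfolding norm_mult by linarith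
  then show "AE x in lborel. norm (f x * g x) \<le> norm ((cmod (f x))\<^sup>2 + (cmod (g x))\<^sup>2)"
    by auto
  show "(\<lambda>x. f x * g x) \<in> borel_measurable lborel" by simp
qed

text \<open>Cauchy-Schwarz. It carries both sides of Parseval along the sequence that defines the
  Fourier transform.\<close>

lemma l2_inner_tendsto:
  assumes u: "square_integrable u" and g: "\<And>k. square_integrable (g k)" and f: "square_integrable f"
    and lim: "l2_tendsto g f"
  shows "(\<lambda>k. l2_inner u (g k)) \<longlonglongrightarrow> l2_inner u f"
proof -
  note [measurable] = square_integrable_measurable[OF u] square_integrable_measurable[OF f]
    square_integrable_measurable[OF g]
  let ?D = "\<lambda>k. \<integral>\<^sup>+x. ennreal ((cmod (g k x - f x))\<^sup>2) \<partial>lborel"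
  let ?A = "\<integral>\<^sup>+x. ennreal ((cmod (u x))\<^sup>2) \<partial>lborel"
  have le: "ennreal ((cmod (l2_inner u (g k) - l2_inner u f))\<^sup>2) \<le> ?A * ?D k" for k
  proof -
    have "l2_inner u (g k) - l2_inner u f = (LINT x|lborel. u x * cnj (g k x - f x))"
      unfolding l2_inner_def complex_cnj_diff right_diff_distrib
      by (rule Bochner_Integration.integral_diff[symmetric])
        (intro integrable_square_mult square_integrable_cnj u g f)+
    then have "ennreal (cmod (l2_inner u (g k) - l2_inner u f)) \<le> (\<integral>\<^sup>+x. ennreal (cmod (u x)) * ennreal (cmod (g k x - f x)) \<partial>lborel)"
      using ennreal_norm_integral_le[of lborel "\<lambda>x. u x * cnj (g k x - f x)"]
      by (simp add: norm_mult ennreal_mult del: complex_cnj_diff)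
    then have "(ennreal (cmod (l2_inner u (g k) - l2_inner u f)))\<^sup>2 \<le> (\<integral>\<^sup>+x. ennreal (cmod (u x)) * ennreal (cmod (g k x - f x)) \<partial>lborel)\<^sup>2"
      by (rule power_mono) simp
    also have "\<dots> \<le> (\<integral>\<^sup>+x. (ennreal (cmod (u x)))\<^sup>2 \<partial>lborel) * (\<integral>\<^sup>+x. (ennreal (cmod (g k x - f x)))\<^sup>2 \<partial>lborel)"
      by (rule Cauchy_Schwarz_nn_integral) simp_all
    finally show ?thesis by (simp add: ennreal_power)
  qed
  have "(\<lambda>k. ?A * ?D k) \<longlonglongrightarrow> ?A * 0"
    using lim u by (intro ennreal_tendsto_cmult) (auto simp: l2_tendsto_def square_integrable_iff)
  then have D0: "(\<lambda>k. ?A * ?D k) \<longlonglongrightarrow> 0" by simp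
  have "(\<lambda>k. ennreal ((cmod (l2_inner u (g k) - l2_inner u f))\<^sup>2)) \<longlonglongrightarrow> 0"
    by (rule tendsto_sandwich[OF _ _ tendsto_const D0]) (intro always_eventually allI zero_le le)+
  then have "(\<lambda>k. ennreal ((cmod (l2_inner u (g k) - l2_inner u f))\<^sup>2)) \<longlonglongrightarrow> ennreal 0"
    by simp
  then have "(\<lambda>k. (cmod (l2_inner u (g k) - l2_inner u f))\<^sup>2) \<longlonglongrightarrow> 0"
    by (subst (asm) tendsto_ennreal_iff) (auto intro!: always_eventually)
  from tendsto_real_sqrt[OF this] have "(\<lambda>k. cmod (l2_inner u (g k) - l2_inner u f)) \<longlonglongrightarrow> 0"
    by simp
  then have "(\<lambda>k. l2_inner u (g k) - l2_inner u f) \<longlonglongrightarrow> 0"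
    by (rule tendsto_norm_zero_cancel)
  then show ?thesis by (rule LIM_zero_cancel)
qed

lemma complex_polarization:
  "4 * (a * cnj b) = of_real ((cmod (a + b))\<^sup>2) - of_real ((cmod (a - b))\<^sup>2)
    + \<i> * of_real ((cmod (a + \<i> * b))\<^sup>2) - \<i> * of_real ((cmod (a - \<i> * b))\<^sup>2)"
  by (simp add: complex_eq_iff cmod_power2) (simp add: power2_eq_square algebra_simps)

lemma l2_inner_polarization:
  assumes "square_integrable f" "square_integrable g"
  shows "4 * l2_inner f g = of_real (LINT x|lborel. (cmod (f x + g x))\<^sup>2) - of_real (LINT x|lborel. (cmod (f x - g x))\<^sup>2)
    + \<i> * of_real (LINT x|lborel. (cmod (f x + \<i> * g x))\<^sup>2) - \<i> * of_real (LINT x|lborel. (cmod (f x - \<i> * g x))\<^sup>2)"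
proof -
  have "integrable lborel (\<lambda>x. complex_of_real ((cmod (f x + g x))\<^sup>2))"
    "integrable lborel (\<lambda>x. complex_of_real ((cmod (f x - g x))\<^sup>2))"
    "integrable lborel (\<lambda>x. complex_of_real ((cmod (f x + \<i> * g x))\<^sup>2))"
    "integrable lborel (\<lambda>x. complex_of_real ((cmod (f x - \<i> * g x))\<^sup>2))"
    using square_integrable_add[OF assms] square_integrable_diff[OF assms]
      square_integrable_add[OF assms(1) square_integrable_cmult[OF assms(2)], of \<i>]
      square_integrable_diff[OF assms(1) square_integrable_cmult[OF assms(2)], of \<i>]
    unfolding square_integrable_def by (intro integrable_of_real, simp)+
  note int = this
  have lin: "(LINT x|lborel. a x - b x + \<i> * c x - \<i> * d x)
      = (LINT x|lborel. a x) - (LINT x|lborel. b x) + \<i> * (LINT x|lborel. c x) - \<i> * (LINT x|lborel. d x)"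
    if "integrable lborel a" "integrable lborel b" "integrable lborel c" "integrable lborel d"
    for a b c d :: "'a \<Rightarrow> complex"
    using that by simp
  have "4 * l2_inner f g = (LINT x|lborel. 4 * (f x * cnj (g x)))"
    by (simp add: l2_inner_def)
  also have "\<dots> = (LINT x|lborel. complex_of_real ((cmod (f x + g x))\<^sup>2)) - (LINT x|lborel. complex_of_real ((cmod (f x - g x))\<^sup>2))
      + \<i> * (LINT x|lborel. complex_of_real ((cmod (f x + \<i> * g x))\<^sup>2))
      - \<i> * (LINT x|lborel. complex_of_real ((cmod (f x - \<i> * g x))\<^sup>2))"
    unfolding complex_polarization by (rule lin[OF int])
  finally show ?thesis unfolding integral_complex_of_real .
qed

lemma square_integrable_fourier_integral_iff:
  assumes "integrable lborel f"
  shows "square_integrable (fourier_integral f) \<longleftrightarrow> square_integrable f"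
  using plancherel_L1[OF assms] borel_measurable_integrable[OF assms]
  by (simp add: square_integrable_iff fourier_integral_measurable)

text \<open>Polarisation reduces the claim to Plancherel for f + g, f - g, f + ig and f - ig, which
  are again in L1 and whose transforms are the same combinations pointwise.\<close>

lemma parseval_L1:
  assumes f: "integrable lborel f" "square_integrable f" and g: "integrable lborel g" "square_integrable g"
  shows "l2_inner (fourier_integral f) (fourier_integral g) = l2_inner f g"
proof -
  have norm: "(LINT x|lborel. (cmod (fourier_integral h x))\<^sup>2) = (LINT x|lborel. (cmod (h x))\<^sup>2)"
    if h: "integrable lborel h" for h :: "'a \<Rightarrow> complex"
  proof -
    have [measurable]: "h \<in> borel_measurable borel" using h by auto
    show ?thesis using plancherel_L1[OF h] by (simp add: integral_eq_nn_integral)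
  qed
  have F: "square_integrable (fourier_integral f)" "square_integrable (fourier_integral g)"
    using f g by (simp_all add: square_integrable_fourier_integral_iff)
  have ig: "integrable lborel (\<lambda>x. \<i> * g x)" using g(1) by (rule integrable_mult_right)
  have "4 * l2_inner (fourier_integral f) (fourier_integral g) = 4 * l2_inner f g"
    unfolding l2_inner_polarization[OF F] l2_inner_polarization[OF f(2) g(2)]
      fourier_integral_cmult[symmetric] fourier_integral_add[OF f(1) g(1), symmetric]
      fourier_integral_diff[OF f(1) g(1), symmetric]
      fourier_integral_add[OF f(1) ig, symmetric] fourier_integral_diff[OF f(1) ig, symmetric]
      norm[OF Bochner_Integration.integrable_add[OF f(1) g(1)]] norm[OF Bochner_Integration.integrable_diff[OF f(1) g(1)]]
      norm[OF Bochner_Integration.integrable_add[OF f(1) ig]] norm[OF Bochner_Integration.integrable_diff[OF f(1) ig]] ..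
  then show ?thesis by simp
qed

text \<open>Both sides pass to the limit along the defining sequence of \<open>F\<close>. Keeping
  \<open>u\<close> in L1 and L2 makes its transform a true integral, while \<open>F\<close> may be
  any function that the definition admits.\<close>

theorem parseval_is_fourier_transform:
  assumes u: "integrable lborel u" "square_integrable u" and f: "square_integrable f"
    and F: "is_fourier_transform f F"
  shows "l2_inner u f = l2_inner (fourier_integral u) F"
proof -
  obtain g where g: "\<And>k. integrable lborel (g k)" "\<And>k. square_integrable (g k)"
    "l2_tendsto g f" "l2_tendsto (\<lambda>k. fourier_integral (g k)) F" and F2: "square_integrable F"
    using F unfolding is_fourier_transform_def by blast
  have "(\<lambda>k. l2_inner u (g k)) \<longlonglongrightarrow> l2_inner u f"
    by (rule l2_inner_tendsto[OF u(2) g(2) f g(3)])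
  moreover have "(\<lambda>k. l2_inner (fourier_integral u) (fourier_integral (g k))) \<longlonglongrightarrow> l2_inner (fourier_integral u) F"
    using u g F2 by (intro l2_inner_tendsto) (auto simp: square_integrable_fourier_integral_iff)
  ultimately show ?thesis
    using LIMSEQ_unique by (auto simp: parseval_L1[OF u g(1,2)])
qed

text \<open>
  Multiplication by a positive function in \<open>L\<^sup>2\<close> makes an \<open>L\<^sup>2\<close>-Cauchy sequence Cauchy in \<open>L\<^sup>1\<close>, which
  yields a subsequence converging almost everywhere.
\<close>

lemma l2_complete:
  fixes G :: "nat \<Rightarrow> 'a::euclidean_space \<Rightarrow> complex"
  assumes G: "\<And>k. square_integrable (G k)"
    and Cauchy: "\<And>e::real. e > 0 \<Longrightarrow> \<exists>N. \<forall>i\<ge>N. \<forall>j\<ge>N. (\<integral>\<^sup>+x. ennreal ((cmod (G i x - G j x))\<^sup>2) \<partial>lborel) \<le> ennreal e"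
  obtains F where "square_integrable F" "l2_tendsto G F"
proof -
  note [measurable] = square_integrable_measurable[OF G]
  define w :: "'a \<Rightarrow> complex" where "w = gaussian 1"
  have [measurable]: "w \<in> borel_measurable borel" by (simp add: w_def)
  have w1: "(\<integral>\<^sup>+x. ennreal ((cmod (w x))\<^sup>2) \<partial>lborel) \<le> 1"
  proof -
    have "(\<integral>\<^sup>+x. ennreal ((cmod (w x))\<^sup>2) \<partial>lborel) \<le> (\<integral>\<^sup>+x. ennreal (cmod (w x)) \<partial>lborel)"
      by (intro nn_integral_mono ennreal_leI) (auto simp: w_def norm_gaussian power2_eq_square intro!: mult_left_le)
    then show ?thesis by (simp add: w_def nn_integral_gaussian_1)
  qed
  then have w: "square_integrable w" by (auto simp: square_integrable_iff intro: order_le_less_trans)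
  define s where "s k x = G k x * w x" for k x
  have s_int: "integrable lborel (s k)" for k
    unfolding s_def by (rule integrable_square_mult[OF G w])
  have "\<exists>N. \<forall>i\<ge>N. \<forall>j\<ge>N. (LINT x|lborel. norm (s i x - s j x)) < e" if "e > 0" for e
  proof -
    \<comment> \<open>Cauchy-Schwarz bounds the squared L1 distance by this number times at most 1;
      halving \<open>e\<close> makes the final inequality strict.\<close>
    obtain N where N: "\<And>i j. i \<ge> N \<Longrightarrow> j \<ge> N \<Longrightarrow> (\<integral>\<^sup>+x. ennreal ((cmod (G i x - G j x))\<^sup>2) \<partial>lborel) \<le> ennreal ((e / 2)\<^sup>2)"
      using Cauchy[of "(e / 2)\<^sup>2"] \<open>e > 0\<close> by auto
    have "(LINT x|lborel. norm (s i x - s j x)) < e" if ij: "i \<ge> N" "j \<ge> N" for i j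
    proof -
      let ?L = "LINT x|lborel. norm (s i x - s j x)"
      have "ennreal ?L = (\<integral>\<^sup>+x. ennreal (norm (s i x - s j x)) \<partial>lborel)"
        using s_int by (subst nn_integral_eq_integral) auto
      also have "\<dots> = (\<integral>\<^sup>+x. ennreal (cmod (G i x - G j x)) * ennreal (cmod (w x)) \<partial>lborel)"
        by (simp add: s_def left_diff_distrib[symmetric] norm_mult ennreal_mult)
      finally have "(ennreal ?L)\<^sup>2 = (\<integral>\<^sup>+x. ennreal (cmod (G i x - G j x)) * ennreal (cmod (w x)) \<partial>lborel)\<^sup>2" by simp
      also have "\<dots> \<le> (\<integral>\<^sup>+x. (ennreal (cmod (G i x - G j x)))\<^sup>2 \<partial>lborel) * (\<integral>\<^sup>+x. (ennreal (cmod (w x)))\<^sup>2 \<partial>lborel)"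
        by (rule Cauchy_Schwarz_nn_integral) simp_all
      also have "\<dots> \<le> ennreal ((e / 2)\<^sup>2) * 1"
        using N[OF ij] w1 by (intro mult_mono) (simp_all add: ennreal_power)
      finally have "?L\<^sup>2 \<le> (e / 2)\<^sup>2" by (simp add: ennreal_power)
      then have "?L \<le> e / 2" by (rule power2_le_imp_le) (use \<open>e > 0\<close> in simp)
      then show ?thesis using \<open>e > 0\<close> by simp
    qed
    then show ?thesis by blast
  qed
  from cauchy_L1_AE_cauchy_subseq[OF s_int this]
  obtain r where r: "strict_mono r" "AE x in lborel. Cauchy (\<lambda>i. s (r i) x)" by blast
  \<comment> \<open>\<open>lim\<close> of measurable functions is measurable, and it is a true limit
    off a null set.\<close>
  define F where "F x = lim (\<lambda>n. G (r n) x)" for x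
  have [measurable]: "F \<in> borel_measurable borel"
    unfolding F_def[abs_def] by measurable
  have conv: "AE x in lborel. (\<lambda>n. G (r n) x) \<longlonglongrightarrow> F x"
    using r(2)
  proof eventually_elim
    case (elim x)
    have "w x \<noteq> 0" by (simp add: w_def gaussian_def)
    have "convergent (\<lambda>n. s (r n) x)" using elim by (simp add: Cauchy_convergent_iff)
    then obtain l where "(\<lambda>n. s (r n) x) \<longlonglongrightarrow> l" by (auto simp: convergent_def)
    then have "(\<lambda>n. s (r n) x / w x) \<longlonglongrightarrow> l / w x" using \<open>w x \<noteq> 0\<close> by (intro tendsto_intros)
    then have "(\<lambda>n. G (r n) x) \<longlonglongrightarrow> l / w x" using \<open>w x \<noteq> 0\<close> by (simp add: s_def)
    then show ?case unfolding F_def by (metis limI)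
  qed
  have tail: "\<exists>N. \<forall>i\<ge>N. (\<integral>\<^sup>+x. ennreal ((cmod (G i x - F x))\<^sup>2) \<partial>lborel) \<le> ennreal e" if "e > 0" for e :: real
  proof -
    obtain N where N: "\<And>i j. i \<ge> N \<Longrightarrow> j \<ge> N \<Longrightarrow> (\<integral>\<^sup>+x. ennreal ((cmod (G i x - G j x))\<^sup>2) \<partial>lborel) \<le> ennreal e"
      using Cauchy[OF \<open>e > 0\<close>] by auto
    have "(\<integral>\<^sup>+x. ennreal ((cmod (G i x - F x))\<^sup>2) \<partial>lborel) \<le> ennreal e" if "i \<ge> N" for i
    proof (rule nn_integral_le_of_AE_tendsto)
      \<comment> \<open>Since \<open>r\<close> is strictly increasing, the shift by \<open>N\<close>
        keeps the second index beyond \<open>N\<close>.\<close>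
      show "AE x in lborel. (\<lambda>n. ennreal ((cmod (G i x - G (r (n + N)) x))\<^sup>2)) \<longlonglongrightarrow> ennreal ((cmod (G i x - F x))\<^sup>2)"
        using conv
      proof eventually_elim
        case (elim x)
        then have "(\<lambda>n. G (r (n + N)) x) \<longlonglongrightarrow> F x" by (rule LIMSEQ_ignore_initial_segment)
        then show ?case by (intro tendsto_intros)
      qed
      show "(\<integral>\<^sup>+x. ennreal ((cmod (G i x - G (r (n + N)) x))\<^sup>2) \<partial>lborel) \<le> ennreal e" for n
        using N[OF that, of "r (n + N)"] seq_suble[OF r(1), of "n + N"] by simp
    qed simp_all
    then show ?thesis by blast
  qed
  have "square_integrable F"
  proof -
    obtain i where i: "(\<integral>\<^sup>+x. ennreal ((cmod (G i x - F x))\<^sup>2) \<partial>lborel) \<le> ennreal 1"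
      using tail[of 1] by auto
    have "square_integrable (\<lambda>x. G i x - F x)"
      unfolding square_integrable_iff using i by (auto intro: order_le_less_trans)
    from square_integrable_diff[OF G[of i] this] show ?thesis by simp
  qed
  moreover have "l2_tendsto G F"
    unfolding l2_tendsto_def
  proof (rule order_tendstoI)
    fix a :: ennreal assume "0 < a"
    then obtain c where c: "0 < c" "c < a" using dense by blast
    then obtain e where "c = ennreal e" "e \<ge> 0" by (cases c) auto
    with c have e: "e > 0" "ennreal e < a" by auto
    obtain N where "\<forall>i\<ge>N. (\<integral>\<^sup>+x. ennreal ((cmod (G i x - F x))\<^sup>2) \<partial>lborel) \<le> ennreal e"
      using tail[OF e(1)] by blast
    then show "\<forall>\<^sub>F k in sequentially. (\<integral>\<^sup>+x. ennreal ((cmod (G k x - F x))\<^sup>2) \<partial>lborel) < a"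
      using e(2) by (auto simp: eventually_sequentially intro: order_le_less_trans)
  qed simp
  ultimately show thesis by (rule that)
qed

text \<open>Truncations to balls lie in L1 and L2 and converge to \<open>f\<close>. Plancherel for
  their differences makes the transforms Cauchy in L2, and completeness supplies the limit. This
  justifies the choice in \<open>fourier\<close>.\<close>

lemma is_fourier_transform_exists:
  fixes f :: "'a::euclidean_space \<Rightarrow> complex"
  assumes f: "square_integrable f"
  shows "\<exists>F. is_fourier_transform f F"
proof -
  note [measurable] = square_integrable_measurable[OF f]
  have [measurable]: "cball (0 :: 'a) (real k) \<in> sets borel" for k by (simp add: borel_closed)
  define g where "g k x = indicator (cball 0 (real k)) x *\<^sub>R f x" for k x
  have [measurable]: "g k \<in> borel_measurable borel" for k
    unfolding g_def[abs_def] by measurable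
  have g2: "square_integrable (g k)" for k
  proof -
    have "(\<integral>\<^sup>+x. ennreal ((cmod (g k x))\<^sup>2) \<partial>lborel) \<le> (\<integral>\<^sup>+x. ennreal ((cmod (f x))\<^sup>2) \<partial>lborel)"
      by (intro nn_integral_mono) (auto simp: g_def indicator_def)
    then show ?thesis using f by (auto simp: square_integrable_iff)
  qed
  \<comment> \<open>On a ball L2 lies in L1, because the indicator is itself square
    integrable.\<close>
  have g1: "integrable lborel (g k)" for k
  proof -
    have "emeasure lborel (cball 0 (real k) :: 'a set) < \<infinity>"
      by (rule emeasure_bounded_finite) simp
    moreover have ind: "(\<lambda>x::'a. (cmod (complex_of_real (indicator (cball 0 (real k)) x)))\<^sup>2) = indicator (cball 0 (real k))"
      by (auto simp: indicator_def fun_eq_iff)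
    ultimately have "square_integrable (\<lambda>x::'a. complex_of_real (indicator (cball 0 (real k)) x))"
      unfolding square_integrable_def ind by (simp add: integrable_indicator_iff)
    from integrable_square_mult[OF this f] show ?thesis
      by (simp add: g_def[abs_def] scaleR_conv_of_real)
  qed
  have gf: "l2_tendsto g f"
    unfolding l2_tendsto_def
  proof -
    have "(\<lambda>k. \<integral>\<^sup>+x. ennreal ((cmod (g k x - f x))\<^sup>2) \<partial>lborel) \<longlonglongrightarrow> (\<integral>\<^sup>+x. 0 \<partial>(lborel :: 'a measure))"
    proof (rule nn_integral_dominated_convergence[where w = "\<lambda>x. ennreal ((cmod (f x))\<^sup>2)"])
      show "AE x in lborel. (\<lambda>k. ennreal ((cmod (g k x - f x))\<^sup>2)) \<longlonglongrightarrow> 0"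
      proof (rule AE_I2)
        fix x :: 'a
        obtain N where "norm x \<le> real N" using real_arch_simple by blast
        then have "\<forall>\<^sub>F k in sequentially. ennreal ((cmod (g k x - f x))\<^sup>2) = 0"
          unfolding eventually_sequentially by (intro exI[of _ N]) (auto simp: g_def)
        then show "(\<lambda>k. ennreal ((cmod (g k x - f x))\<^sup>2)) \<longlonglongrightarrow> 0" by (rule tendsto_eventually)
      qed
    qed (use f in \<open>auto simp: g_def indicator_def square_integrable_iff\<close>)
    then show "(\<lambda>k. \<integral>\<^sup>+x. ennreal ((cmod (g k x - f x))\<^sup>2) \<partial>lborel) \<longlonglongrightarrow> 0" by simp
  qed
  have G2: "square_integrable (fourier_integral (g k))" for k
    using g1 g2 by (simp add: square_integrable_fourier_integral_iff)
  have "\<exists>N. \<forall>i\<ge>N. \<forall>j\<ge>N. (\<integral>\<^sup>+x. ennreal ((cmod (fourier_integral (g i) x - fourier_integral (g j) x))\<^sup>2) \<partial>lborel) \<le> ennreal e"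
    if "e > 0" for e :: real
  proof -
    \<comment> \<open>Squaring a sum costs a factor 2 per term, so e/4 yields 2(e/4) + 2(e/4) =
      e.\<close>
    have "\<forall>\<^sub>F k in sequentially. (\<integral>\<^sup>+x. ennreal ((cmod (g k x - f x))\<^sup>2) \<partial>lborel) < ennreal (e / 4)"
      using gf that unfolding l2_tendsto_def by (intro order_tendstoD(2)) auto
    then obtain N where N: "\<And>k. k \<ge> N \<Longrightarrow> (\<integral>\<^sup>+x. ennreal ((cmod (g k x - f x))\<^sup>2) \<partial>lborel) < ennreal (e / 4)"
      by (auto simp: eventually_sequentially)
    have "(\<integral>\<^sup>+x. ennreal ((cmod (fourier_integral (g i) x - fourier_integral (g j) x))\<^sup>2) \<partial>lborel) \<le> ennreal e"
      if ij: "i \<ge> N" "j \<ge> N" for i j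
    proof -
      have "(\<integral>\<^sup>+x. ennreal ((cmod (fourier_integral (g i) x - fourier_integral (g j) x))\<^sup>2) \<partial>lborel)
          = (\<integral>\<^sup>+x. ennreal ((cmod ((g i x - f x) + (f x - g j x)))\<^sup>2) \<partial>lborel)"
        using plancherel_L1[OF Bochner_Integration.integrable_diff[OF g1[of i] g1[of j]]]
        by (simp add: fourier_integral_diff[OF g1 g1])
      also have "\<dots> \<le> 2 * (\<integral>\<^sup>+x. ennreal ((cmod (g i x - f x))\<^sup>2) \<partial>lborel) + 2 * (\<integral>\<^sup>+x. ennreal ((cmod (f x - g j x))\<^sup>2) \<partial>lborel)"
        by (rule nn_integral_add_square_le) simp_all
      also have "\<dots> \<le> 2 * ennreal (e / 4) + 2 * ennreal (e / 4)"
        using N[OF ij(1)] N[OF ij(2)] by (intro add_mono mult_left_mono) (auto simp: norm_minus_commute)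
      also have "\<dots> = ennreal (2 * (e / 4)) + ennreal (2 * (e / 4))"
        using \<open>e > 0\<close> by (subst (1 2) ennreal_mult) auto
      also have "\<dots> = ennreal e"
        using \<open>e > 0\<close> by (subst ennreal_plus[symmetric]) auto
      finally show ?thesis by simp
    qed
    then show ?thesis by blast
  qed
  from l2_complete[OF G2 this] obtain F where "square_integrable F" "l2_tendsto (\<lambda>k. fourier_integral (g k)) F"
    by blast
  then show ?thesis
    unfolding is_fourier_transform_def using g1 g2 gf by blast
qed

lemma is_fourier_transform_fourier:
  "square_integrable f \<Longrightarrow> is_fourier_transform f (fourier f)"
  unfolding fourier_def using is_fourier_transform_exists by (rule someI_ex)

section \<open>Fourier transforms of dilated and translated functions\<close>

text \<open>The \<open>T\<close>-preimage of the \<open>S\<close>-preimage of \<open>A\<close> is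
  \<open>A\<close>, so the scaling law of \<open>T\<close> for the \<open>S\<close>-preimage is that
  of \<open>S\<close> with the inverse factor.\<close>

lemma scales_lborel_inverse:
  assumes T: "scales_lborel T J" and [measurable]: "S \<in> borel \<rightarrow>\<^sub>M borel" and ST: "\<And>x. S (T x) = x"
  shows "scales_lborel S (1 / J)"
proof (rule scales_lborelI)
  note [measurable] = scales_lborelD(1)[OF T]
  have J: "J > 0" by (rule scales_lborelD(2)[OF T])
  then show "1 / J > 0" by simp
  fix A :: "'a set" assume [measurable]: "A \<in> sets borel"
  have [measurable]: "S -` A \<in> sets borel" using measurable_sets[of S borel borel A] by simp
  have "emeasure lborel (S -` A) = (\<integral>\<^sup>+x. indicator (S -` A) x \<partial>lborel)" by simp
  also have "\<dots> = ennreal J * (\<integral>\<^sup>+x. indicator (S -` A) (T x) \<partial>lborel)"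
    by (rule scales_lborel_nn_integral[OF T]) simp
  also have "(\<lambda>x. indicator (S -` A) (T x) :: ennreal) = indicator A"
    by (auto simp: indicator_def ST)
  finally have "emeasure lborel (S -` A) = ennreal J * emeasure lborel A" by simp
  then show "emeasure lborel A = ennreal (1 / J) * emeasure lborel (S -` A)"
    using J by (simp add: mult.assoc[symmetric] ennreal_mult[symmetric])
qed simp

lemma square_integrable_scales:
  assumes f: "square_integrable f" and P: "scales_lborel P K"
    and [measurable]: "m \<in> borel_measurable borel" and C: "\<And>x. cmod (m x) \<le> C"
  shows "square_integrable (\<lambda>x. m x * f (P x))"
proof -
  note [measurable] = square_integrable_measurable[OF f] scales_lborelD(1)[OF P]
  have "integrable lborel (\<lambda>x. (cmod (f x))\<^sup>2)" using f by (simp add: square_integrable_def)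
  from scales_lborel_integrable[OF P this] have "integrable lborel (\<lambda>x. C\<^sup>2 * (cmod (f (P x)))\<^sup>2)"
    by (rule integrable_mult_right)
  then have "integrable lborel (\<lambda>x. (cmod (m x * f (P x)))\<^sup>2)"
    by (rule Bochner_Integration.integrable_bound)
      (auto simp: norm_mult power_mult_distrib intro!: mult_right_mono power_mono C)
  then show ?thesis by (simp add: square_integrable_def)
qed

text \<open>The multiplier costs \<open>C\<^sup>2\<close> and the substitution 1/K. A bounded
  \<open>m\<close> covers the constant on the space side and the translation phase on the frequency
  side.\<close>

lemma l2_tendsto_scales:
  assumes gf: "l2_tendsto g f" and [measurable]: "\<And>k. g k \<in> borel_measurable borel" "f \<in> borel_measurable borel"
    and P: "scales_lborel P K" and C: "\<And>x. cmod (m x) \<le> C"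
  shows "l2_tendsto (\<lambda>k x. m x * g k (P x)) (\<lambda>x. m x * f (P x))"
  unfolding l2_tendsto_def
proof (rule tendsto_sandwich[OF _ _ tendsto_const])
  note [measurable] = scales_lborelD(1)[OF P]
  let ?D = "\<lambda>k. \<integral>\<^sup>+x. ennreal ((cmod (g k x - f x))\<^sup>2) \<partial>lborel"
  have K: "K > 0" by (rule scales_lborelD(2)[OF P])
  have C0: "C \<ge> 0" using C[of undefined] norm_ge_zero order_trans by blast
  show "(\<lambda>k. ennreal (C\<^sup>2 / K) * ?D k) \<longlonglongrightarrow> 0"
    using ennreal_tendsto_cmult[OF _ gf[unfolded l2_tendsto_def], of "ennreal (C\<^sup>2 / K)"] by simp
  have "(\<integral>\<^sup>+x. ennreal ((cmod (m x * g k (P x) - m x * f (P x)))\<^sup>2) \<partial>lborel) \<le> ennreal (C\<^sup>2 / K) * ?D k" for k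
  proof -
    have "(\<integral>\<^sup>+x. ennreal ((cmod (m x * g k (P x) - m x * f (P x)))\<^sup>2) \<partial>lborel)
        \<le> (\<integral>\<^sup>+x. ennreal (C\<^sup>2) * ennreal ((cmod (g k (P x) - f (P x)))\<^sup>2) \<partial>lborel)"
      by (intro nn_integral_mono) (auto simp: right_diff_distrib[symmetric] norm_mult power_mult_distrib
          ennreal_mult[symmetric] intro!: ennreal_leI mult_right_mono power_mono C)
    also have "\<dots> = ennreal (C\<^sup>2) * (\<integral>\<^sup>+x. ennreal ((cmod (g k (P x) - f (P x)))\<^sup>2) \<partial>lborel)"
      by (rule nn_integral_cmult) simp
    also have "\<dots> = ennreal (C\<^sup>2 / K) * ?D k"
    proof -
      have "?D k = ennreal K * (\<integral>\<^sup>+x. ennreal ((cmod (g k (P x) - f (P x)))\<^sup>2) \<partial>lborel)"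
        by (rule scales_lborel_nn_integral[OF P]) simp
      then show ?thesis using K by (simp add: mult.assoc[symmetric] ennreal_mult[symmetric])
    qed
    finally show ?thesis .
  qed
  then show "\<forall>\<^sub>F k in sequentially. (\<integral>\<^sup>+x. ennreal ((cmod (m x * g k (P x) - m x * f (P x)))\<^sup>2) \<partial>lborel) \<le> ennreal (C\<^sup>2 / K) * ?D k"
    by simp
qed simp

text \<open>After substituting b + T x for x, the vector \<open>b\<close> produces the phase and
  \<open>adj\<close> moves \<open>T\<close> to the frequency as its transpose \<open>T'\<close>.
  Taking \<open>S\<close> and \<open>T'\<close> as maps lets the rule apply to multiplication by
  \<open>a\<close> on the line as well as to matrices.\<close>

lemma fourier_integral_linear_pullback:
  fixes g :: "'a::euclidean_space \<Rightarrow> complex"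
  assumes T: "scales_lborel T J" and [measurable]: "S \<in> borel \<rightarrow>\<^sub>M borel" and ST: "\<And>x. S (T x) = x"
    and adj: "\<And>\<xi> x. \<xi> \<bullet> T x = T' \<xi> \<bullet> x" and [measurable]: "g \<in> borel_measurable borel"
  shows "fourier_integral (\<lambda>x. c * g (S (x - b))) \<xi>
    = c * of_real J * cis (- 2 * pi * (\<xi> \<bullet> b)) * fourier_integral g (T' \<xi>)"
proof -
  have sc: "scales_lborel (\<lambda>x. b + T x) J"
    using scales_lborel_comp[OF scales_lborel_affine[of 1 b] T] by simp
  have cis_split: "cis (- 2 * pi * (\<xi> \<bullet> (b + T x))) = cis (- 2 * pi * (\<xi> \<bullet> b)) * cis (- 2 * pi * (T' \<xi> \<bullet> x))" for x
    by (simp add: cis_mult inner_add_right adj distrib_left)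
  have "fourier_integral (\<lambda>x. c * g (S (x - b))) \<xi>
      = J *\<^sub>R (LINT x|lborel. c * g (S (b + T x - b)) * cis (- 2 * pi * (\<xi> \<bullet> (b + T x))))"
    unfolding fourier_integral_def by (rule scales_lborel_integral[OF sc]) simp
  also have "\<dots> = J *\<^sub>R (LINT x|lborel. (c * cis (- 2 * pi * (\<xi> \<bullet> b))) * (g x * cis (- 2 * pi * (T' \<xi> \<bullet> x))))"
    unfolding cis_split by (simp only: add_diff_cancel_left' ST mult_ac)
  also have "\<dots> = c * of_real J * cis (- 2 * pi * (\<xi> \<bullet> b)) * fourier_integral g (T' \<xi>)"
    unfolding integral_mult_right_zero fourier_integral_def by (simp add: scaleR_conv_of_real)
  finally show ?thesis .
qed

text \<open>The approximating sequence is pulled back along with \<open>f\<close>. The scaling law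
  of \<open>T'\<close> carries the L2 convergence over to the frequency side.\<close>

lemma is_fourier_transform_linear_pullback:
  fixes f :: "'a::euclidean_space \<Rightarrow> complex"
  assumes F: "is_fourier_transform f F" and f: "square_integrable f"
    and T: "scales_lborel T J" and S [measurable]: "S \<in> borel \<rightarrow>\<^sub>M borel" and ST: "\<And>x. S (T x) = x"
    and adj: "\<And>\<xi> x. \<xi> \<bullet> T x = T' \<xi> \<bullet> x" and T': "scales_lborel T' J"
  shows "square_integrable (\<lambda>x. c * f (S (x - b)))"
    and "is_fourier_transform (\<lambda>x. c * f (S (x - b)))
      (\<lambda>\<xi>. c * of_real J * cis (- 2 * pi * (\<xi> \<bullet> b)) * F (T' \<xi>))"
proof -
  obtain g where g: "\<And>k. integrable lborel (g k)" "\<And>k. square_integrable (g k)"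
    "l2_tendsto g f" "l2_tendsto (\<lambda>k. fourier_integral (g k)) F" and F2: "square_integrable F"
    using F unfolding is_fourier_transform_def by blast
  note [measurable] = square_integrable_measurable[OF f] square_integrable_measurable[OF F2]
    square_integrable_measurable[OF g(2)]
  have S': "scales_lborel (\<lambda>x. S (x - b)) (1 / J)"
    using scales_lborel_comp[OF scales_lborel_inverse[OF T S ST] scales_lborel_translate[of b]] by simp
  have J: "J > 0" by (rule scales_lborelD(2)[OF T])
  let ?m = "\<lambda>\<xi>. c * of_real J * cis (- 2 * pi * (\<xi> \<bullet> b))"
  have m: "cmod (?m \<xi>) \<le> cmod c * J" for \<xi> using J by (simp add: norm_mult)
  have sq: "square_integrable (\<lambda>x. c * h (S (x - b)))" if "square_integrable h" for h :: "'a \<Rightarrow> complex"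
    by (rule square_integrable_scales[OF that S', of "\<lambda>_. c" "cmod c"]) auto
  show "square_integrable (\<lambda>x. c * f (S (x - b)))" by (rule sq[OF f])
  show "is_fourier_transform (\<lambda>x. c * f (S (x - b))) (\<lambda>\<xi>. ?m \<xi> * F (T' \<xi>))"
    unfolding is_fourier_transform_def
  proof (intro conjI exI[of _ "\<lambda>k x. c * g k (S (x - b))"] allI)
    show "square_integrable (\<lambda>\<xi>. ?m \<xi> * F (T' \<xi>))"
      by (rule square_integrable_scales[OF F2 T' _ m]) simp
    show "integrable lborel (\<lambda>x. c * g k (S (x - b)))" for k
      by (intro integrable_mult_right scales_lborel_integrable[OF S' g(1)])
    show "square_integrable (\<lambda>x. c * g k (S (x - b)))" for k by (rule sq[OF g(2)])
    show "l2_tendsto (\<lambda>k x. c * g k (S (x - b))) (\<lambda>x. c * f (S (x - b)))"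
      by (rule l2_tendsto_scales[OF g(3) _ _ S', of "\<lambda>_. c" "cmod c"]) auto
    have "fourier_integral (\<lambda>x. c * g k (S (x - b))) = (\<lambda>\<xi>. ?m \<xi> * fourier_integral (g k) (T' \<xi>))" for k
      by (rule ext, rule fourier_integral_linear_pullback[OF T S ST adj]) simp
    then show "l2_tendsto (\<lambda>k. fourier_integral (\<lambda>x. c * g k (S (x - b)))) (\<lambda>\<xi>. ?m \<xi> * F (T' \<xi>))"
      using l2_tendsto_scales[OF g(4) _ _ T', of ?m "cmod c * J"] m by simp
  qed
qed

section \<open>Linear changes of variables\<close>

lemma prod_Basis_cart:
  fixes f :: "real ^ 'n \<Rightarrow> 'b::comm_monoid_mult"
  shows "(\<Prod>b\<in>Basis. f b) = (\<Prod>i\<in>UNIV. f (axis i 1))"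
proof -
  have B: "(Basis :: (real ^ 'n) set) = range (\<lambda>i. axis i 1)"
    by (auto simp: Basis_vec_def)
  have "inj (\<lambda>i::'n. axis i (1::real))"
    by (auto intro!: injI simp: axis_eq_axis)
  from prod.reindex[OF this, of f] show ?thesis unfolding B by (simp add: o_def)
qed

lemma emeasure_lborel_box_cart:
  fixes l u :: "real ^ 'n"
  assumes "\<And>i. l $ i \<le> u $ i"
  shows "emeasure lborel (box l u) = ennreal (\<Prod>i\<in>UNIV. u $ i - l $ i)"
proof -
  have "emeasure lborel (box l u) = ennreal (\<Prod>b\<in>Basis. (u - l) \<bullet> b)"
    using assms by (intro emeasure_lborel_box) (auto simp: Basis_vec_def inner_axis)
  then show ?thesis by (simp add: prod_Basis_cart inner_axis)
qed

lemma scales_lborel_stretch: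
  fixes c :: "'n::finite \<Rightarrow> real"
  assumes "\<And>i. c i \<noteq> 0"
  shows "scales_lborel (\<lambda>x. \<chi> i. c i * x $ i) \<bar>\<Prod>i\<in>UNIV. c i\<bar>"
proof -
  define C :: "real ^ 'n" where "C = (\<chi> i. c i)"
  have T: "(0 + (\<Sum>j\<in>Basis. ((C \<bullet> j) * (x \<bullet> j)) *\<^sub>R j)) = (\<chi> i. c i * x $ i)" for x
  proof (rule euclidean_eqI)
    fix b :: "real ^ 'n" assume b: "b \<in> Basis"
    then obtain i where i: "b = axis i 1" by (auto simp: Basis_vec_def)
    have "(0 + (\<Sum>j\<in>Basis. ((C \<bullet> j) * (x \<bullet> j)) *\<^sub>R j)) \<bullet> b = (C \<bullet> b) * (x \<bullet> b)"
      unfolding add_0 using b by (rule inner_sum_left_Basis)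
    then show "(0 + (\<Sum>j\<in>Basis. ((C \<bullet> j) * (x \<bullet> j)) *\<^sub>R j)) \<bullet> b = (\<chi> i. c i * x $ i) \<bullet> b"
      by (simp add: i inner_axis C_def)
  qed
  have "C \<bullet> j \<noteq> 0" if "j \<in> Basis" for j
    using that assms by (auto simp: Basis_vec_def inner_axis C_def)
  from lborel_affine_euclidean[of "\<lambda>j. C \<bullet> j" 0, OF this, unfolded T]
  have "lborel = density (distr lborel borel (\<lambda>x. \<chi> i. c i * x $ i)) (\<lambda>_. ennreal \<bar>\<Prod>i\<in>UNIV. c i\<bar>)"
    by (simp add: prod_Basis_cart inner_axis C_def abs_prod prod_ennreal)
  moreover have "(\<lambda>x. \<chi> i. c i * x $ i) \<in> borel \<rightarrow>\<^sub>M (borel :: (real ^ 'n) measure)"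
    unfolding T[symmetric] by measurable
  ultimately show ?thesis using assms by (simp add: scales_lborel_def)
qed

text \<open>Permuting coordinates maps boxes to boxes and only reorders the side lengths, and
  \<open>lborel\<close> is determined by its values on boxes.\<close>

lemma scales_lborel_permute:
  fixes p :: "'n::finite \<Rightarrow> 'n"
  assumes p: "p permutes UNIV"
  shows "scales_lborel (\<lambda>x :: real ^ 'n. \<chi> i. x $ p i) 1"
proof -
  define q where "q = inv_into UNIV p"
  have q: "q permutes UNIV" unfolding q_def by (rule permutes_inv[OF p])
  have pq: "p (q i) = i" "q (p i) = i" for i
    unfolding q_def using permutes_inverses[OF p] by auto
  let ?h = "\<lambda>q x. (\<chi> i. x $ q i) :: real ^ 'n"
  have "linear (?h p)" by (rule linearI) (simp_all add: vec_eq_iff)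
  then have h [measurable]: "?h p \<in> borel \<rightarrow>\<^sub>M borel"
    by (intro borel_measurable_continuous_onI linear_continuous_on linear_linear[THEN iffD2])
  have "lborel = distr lborel borel (?h p)"
  proof (rule lborel_eqI)
    fix l u :: "real ^ 'n"
    assume "\<And>b. b \<in> Basis \<Longrightarrow> l \<bullet> b \<le> u \<bullet> b"
    then have le: "l $ i \<le> u $ i" for i
      by (metis axis_in_Basis_iff cart_eq_inner_axis insertI1 Basis_real_def)
    have "?h p -` box l u = box (?h q l) (?h q u)"
    proof (rule Set.set_eqI)
      fix x :: "real ^ 'n"
      have "(\<forall>i. l $ i < x $ p i \<and> x $ p i < u $ i)
          \<longleftrightarrow> (\<forall>i. l $ q i < x $ i \<and> x $ i < u $ q i)"
        by (metis pq)
      then show "x \<in> ?h p -` box l u \<longleftrightarrow> x \<in> box (?h q l) (?h q u)"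
        by (simp add: mem_box_cart)
    qed
    then have "emeasure (distr lborel borel (?h p)) (box l u) = emeasure lborel (box (?h q l) (?h q u))"
      by (simp add: emeasure_distr)
    also have "\<dots> = (\<Prod>b\<in>Basis. (?h q u - ?h q l) \<bullet> b)"
      by (subst emeasure_lborel_box) (auto simp: Basis_vec_def inner_axis le)
    also have "\<dots> = (\<Prod>i\<in>UNIV. (u - l) $ q i)"
      by (simp add: prod_Basis_cart inner_axis)
    also have "\<dots> = (\<Prod>i\<in>UNIV. (u - l) $ i)"
      using prod.permute[OF q, of "\<lambda>i. (u - l) $ i"] by (simp add: o_def)
    finally show "emeasure (distr lborel borel (?h p)) (box l u) = (\<Prod>b\<in>Basis. (u - l) \<bullet> b)"
      by (simp add: prod_Basis_cart inner_axis)
  qed simp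
  then show ?thesis using h by (simp add: scales_lborel_def density_1)
qed

text \<open>Integrate first over the coordinate along \<open>a\<close>. Since a \<noteq> b the
  coordinate along \<open>b\<close> is then frozen, and the shear is a translation of the inner
  variable.\<close>

lemma scales_lborel_shear:
  fixes a b :: "'a::euclidean_space"
  assumes a: "a \<in> Basis" and b: "b \<in> Basis" and ab: "a \<noteq> b"
  shows "scales_lborel (\<lambda>x. x + (x \<bullet> b) *\<^sub>R a) 1"
proof (rule scales_lborelI)
  fix A :: "'a set" assume [measurable]: "A \<in> sets borel"
  let ?T = "\<lambda>x. x + (x \<bullet> b) *\<^sub>R a"
  interpret P: product_sigma_finite "\<lambda>_::'a. lborel :: real measure" ..
  define E :: "('a \<Rightarrow> real) \<Rightarrow> 'a" where "E f = (\<Sum>b\<in>Basis. f b *\<^sub>R b)" for f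
  have E_meas: "E \<in> Pi\<^sub>M (insert a (Basis - {a})) (\<lambda>_. lborel) \<rightarrow>\<^sub>M borel"
    unfolding E_def[abs_def] using a by measurable
  have B: "insert a (Basis - {a}) = Basis" using a by auto
  have lb: "(lborel :: 'a measure) = distr (Pi\<^sub>M (insert a (Basis - {a})) (\<lambda>_. lborel)) borel E"
    unfolding B E_def[abs_def] by (rule lborel_eq)
  have fubini: "(\<integral>\<^sup>+x. F x \<partial>lborel)
      = (\<integral>\<^sup>+x. \<integral>\<^sup>+y. F (E (x(a := y))) \<partial>lborel \<partial>Pi\<^sub>M (Basis - {a}) (\<lambda>_. lborel))"
    if [measurable]: "F \<in> borel_measurable borel" for F :: "'a \<Rightarrow> ennreal"
  proof -
    have "(\<integral>\<^sup>+x. F x \<partial>lborel) = (\<integral>\<^sup>+f. F (E f) \<partial>Pi\<^sub>M (insert a (Basis - {a})) (\<lambda>_. lborel))"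
      unfolding lb by (rule nn_integral_distr[OF E_meas]) simp
    also have "\<dots> = (\<integral>\<^sup>+x. \<integral>\<^sup>+y. F (E (x(a := y))) \<partial>lborel \<partial>Pi\<^sub>M (Basis - {a}) (\<lambda>_. lborel))"
      by (rule P.product_nn_integral_insert) (use E_meas in auto)
    finally show ?thesis .
  qed
  have E_upd: "E (x(a := y)) = (\<Sum>b\<in>Basis - {a}. x b *\<^sub>R b) + y *\<^sub>R a" for x y
    unfolding E_def using a by (subst sum.remove[of _ a]) (auto simp: add.commute)
  have E_inner: "E (x(a := y)) \<bullet> b = x b" for x y
    unfolding E_def using b ab by (simp add: inner_sum_left_Basis)
  have T_meas: "?T \<in> borel \<rightarrow>\<^sub>M borel" by measurable
  have "emeasure lborel (?T -` A) = (\<integral>\<^sup>+x. indicator (?T -` A) x \<partial>lborel)"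
    by (rule nn_integral_indicator[symmetric]) (use measurable_sets[OF T_meas, of A] in simp)
  also have "\<dots> = (\<integral>\<^sup>+x. indicator A (?T x) \<partial>lborel)" by (simp add: indicator_def)
  \<comment> \<open>The factor 1 gives the inner substitution the shape of the one-dimensional
    affine rule.\<close>
  also have "\<dots> = (\<integral>\<^sup>+x. \<integral>\<^sup>+y. indicator A (E (x(a := x b + 1 * y))) \<partial>lborel \<partial>Pi\<^sub>M (Basis - {a}) (\<lambda>_. lborel))"
  proof (subst fubini)
    have "E (x(a := y)) + (E (x(a := y)) \<bullet> b) *\<^sub>R a = E (x(a := x b + 1 * y))" for x y
      unfolding E_inner unfolding E_upd by (simp add: algebra_simps)
    then show "(\<integral>\<^sup>+x. \<integral>\<^sup>+y. indicator A (?T (E (x(a := y)))) \<partial>lborel \<partial>Pi\<^sub>M (Basis - {a}) (\<lambda>_. lborel))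
      = (\<integral>\<^sup>+x. \<integral>\<^sup>+y. indicator A (E (x(a := x b + 1 * y))) \<partial>lborel \<partial>Pi\<^sub>M (Basis - {a}) (\<lambda>_. lborel))" by simp
  qed simp
  also have "\<dots> = (\<integral>\<^sup>+x. \<integral>\<^sup>+y. indicator A (E (x(a := y))) \<partial>lborel \<partial>Pi\<^sub>M (Basis - {a}) (\<lambda>_. lborel))"
  proof (rule nn_integral_cong)
    fix x :: "'a \<Rightarrow> real"
    have "(\<lambda>y. indicator A (E (x(a := y))) :: ennreal) \<in> borel_measurable borel"
      unfolding E_upd by measurable
    from nn_integral_real_affine[OF this, of 1 "x b"]
    show "(\<integral>\<^sup>+y. indicator A (E (x(a := x b + 1 * y))) \<partial>lborel) = (\<integral>\<^sup>+y. indicator A (E (x(a := y))) \<partial>lborel)"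
      by simp
  qed
  also have "\<dots> = emeasure lborel A" by (subst fubini[symmetric]) simp_all
  finally show "emeasure lborel A = ennreal 1 * emeasure lborel (?T -` A)" by simp
qed simp_all

text \<open>Linear maps are composed of maps with a zero coordinate, stretches, swaps and elementary
  shears. The determinant condition stands inside the induction formula because singular maps occur
  among these; for a composition it passes to both factors, the determinant being
  multiplicative.\<close>

lemma scales_lborel_linear:
  fixes f :: "real ^ 'n \<Rightarrow> real ^ 'n"
  assumes "linear f"
  shows "det (matrix f) \<noteq> 0 \<longrightarrow> scales_lborel f \<bar>det (matrix f)\<bar>"
  using assms
proof (rule induct_linear_elementary)
  fix f g :: "real ^ 'n \<Rightarrow> real ^ 'n"
  assume "linear f" "linear g" and "det (matrix f) \<noteq> 0 \<longrightarrow> scales_lborel f \<bar>det (matrix f)\<bar>"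
    "det (matrix g) \<noteq> 0 \<longrightarrow> scales_lborel g \<bar>det (matrix g)\<bar>"
  moreover have "det (matrix (f \<circ> g)) = det (matrix f) * det (matrix g)"
    using \<open>linear f\<close> \<open>linear g\<close> by (simp add: matrix_compose det_mul)
  ultimately show "det (matrix (f \<circ> g)) \<noteq> 0 \<longrightarrow> scales_lborel (f \<circ> g) \<bar>det (matrix (f \<circ> g))\<bar>"
    using scales_lborel_comp[of f "\<bar>det (matrix f)\<bar>" g "\<bar>det (matrix g)\<bar>"]
    by (simp add: abs_mult comp_def)
next
  fix f :: "real ^ 'n \<Rightarrow> real ^ 'n" and i
  assume "linear f" "\<And>x. f x $ i = 0"
  then have "row i (matrix f) = 0" by (simp add: row_def matrix_def vec_eq_iff)
  then show "det (matrix f) \<noteq> 0 \<longrightarrow> scales_lborel f \<bar>det (matrix f)\<bar>"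
    by (simp add: det_zero_row)
next
  fix c :: "'n \<Rightarrow> real"
  have "det (matrix (\<lambda>x. \<chi> i. c i * x $ i)) = (\<Prod>i\<in>UNIV. c i)"
    by (subst det_diagonal) (auto simp: matrix_def axis_def)
  then show "det (matrix (\<lambda>x. \<chi> i. c i * x $ i)) \<noteq> 0 \<longrightarrow>
      scales_lborel (\<lambda>x. \<chi> i. c i * x $ i) \<bar>det (matrix (\<lambda>x. \<chi> i. c i * x $ i))\<bar>"
    using scales_lborel_stretch[of c] by auto
next
  fix m n :: 'n
  let ?h = "\<lambda>x :: real ^ 'n. \<chi> i. x $ Transposition.transpose m n i"
  have lin: "linear ?h" by (rule linearI) (simp_all add: vec_eq_iff)
  \<comment> \<open>The swap is an involution, so its determinant has square 1.\<close>
  have "?h \<circ> ?h = id" by (simp add: fun_eq_iff vec_eq_iff)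
  then have "matrix ?h ** matrix ?h = mat 1"
    using matrix_compose[OF lin lin] by (simp only: matrix_id_mat_1)
  from arg_cong[OF this, of det] have "det (matrix ?h) * det (matrix ?h) = 1"
    by (simp only: det_mul det_I)
  then have "\<bar>det (matrix ?h)\<bar> = 1"
    by (simp add: abs_square_eq_1 power2_eq_square[symmetric])
  then show "det (matrix ?h) \<noteq> 0 \<longrightarrow> scales_lborel ?h \<bar>det (matrix ?h)\<bar>"
    using scales_lborel_permute[of "Transposition.transpose m n"] by (simp add: permutes_swap_id)
next
  fix m n :: 'n
  let ?h = "\<lambda>x :: real ^ 'n. \<chi> i. if i = m then x $ m + x $ n else x $ i"
  assume mn: "m \<noteq> n"
  have h: "?h = (\<lambda>x. x + (x \<bullet> axis n 1) *\<^sub>R axis m 1)"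
    unfolding fun_eq_iff vec_eq_iff inner_axis by (simp add: axis_def)
  have "scales_lborel ?h 1"
    unfolding h using mn by (intro scales_lborel_shear) (auto simp: axis_eq_axis)
  moreover have "det (matrix ?h) = 1"
  proof -
    have "matrix ?h = (\<chi> k. if k = m then row m (mat 1) + 1 *s row n (mat 1) else row k (mat 1 :: real ^ 'n ^ 'n))"
      using mn by (auto simp: matrix_def mat_def row_def axis_def vec_eq_iff)
    then show ?thesis using det_row_operation[OF mn, of "mat 1 :: real ^ 'n ^ 'n" 1] by (simp add: det_I)
  qed
  ultimately show "det (matrix ?h) \<noteq> 0 \<longrightarrow> scales_lborel ?h \<bar>det (matrix ?h)\<bar>" by simp
qed

lemma scales_lborel_matrix:
  fixes A :: "real ^ 'n ^ 'n"
  assumes "det A \<noteq> 0"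
  shows "scales_lborel ((*v) A) \<bar>det A\<bar>"
  using scales_lborel_linear[of "(*v) A"] assms by simp

text \<open>In the Leibniz formula every permutation other than the identity has some i with p i <
  i, hence a zero factor.\<close>

lemma det_unipotent_upper_triangular:
  fixes A :: "real ^ ('m::{finite,linorder}) ^ ('m::{finite,linorder})"
  assumes "A \<in> unipotent_upper_triangular"
  shows "det A = 1"
proof -
  have A: "\<And>i. A $ i $ i = 1" "\<And>i j. j < i \<Longrightarrow> A $ i $ j = 0"
    using assms by (auto simp: unipotent_upper_triangular_def)
  have "of_int (sign p) * (\<Prod>i\<in>UNIV. A $ i $ p i) = 0" if p: "p permutes UNIV" "p \<noteq> id" for p
  proof -
    have "\<exists>i. p i < i"
    proof (rule ccontr)
      assume "\<nexists>i. p i < i"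
      then have ge: "\<And>i. i \<le> p i" by (auto simp: not_less)
      \<comment> \<open>The image of the largest moved point is moved too, hence not larger; being
        also not smaller, it equals the point, a contradiction.\<close>
      let ?S = "{i. p i \<noteq> i}"
      have "?S \<noteq> {}" using p(2) by (auto simp: fun_eq_iff)
      then have m: "Max ?S \<in> ?S" by (intro Max_in) auto
      then have "p (p (Max ?S)) \<noteq> p (Max ?S)"
        using permutes_inj[OF p(1)] by (auto simp: inj_eq)
      then have "p (Max ?S) \<le> Max ?S" by (intro Max_ge) auto
      then show False using ge[of "Max ?S"] m by auto
    qed
    then obtain i where "p i < i" by blast
    then have "A $ i $ p i = 0" by (rule A)
    then have "(\<Prod>i\<in>UNIV. A $ i $ p i) = 0" by (intro prod_zero) auto
    then show ?thesis by simp
  qed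
  then have "det A = (\<Sum>p\<in>{id}. of_int (sign p) * (\<Prod>i\<in>UNIV. A $ i $ p i))"
    unfolding det_def by (intro sum.mono_neutral_right) (auto simp: permutes_id finite_permutations)
  then show ?thesis by (simp add: A)
qed

section \<open>First coordinate against the rest, and projective coordinates\<close>

lemma UNIV_option_eq: "(UNIV :: 'a option set) = insert None (range Some)"
  by (auto simp: UNIV_option_conv)

lemma sum_UNIV_option:
  fixes g :: "'n::finite option \<Rightarrow> 'b::comm_monoid_add"
  shows "(\<Sum>i\<in>UNIV. g i) = g None + (\<Sum>i\<in>UNIV. g (Some i))"
  unfolding UNIV_option_eq by (subst sum.insert) (auto simp: sum.reindex)

lemma prod_UNIV_option:
  fixes g :: "'n::finite option \<Rightarrow> 'b::comm_monoid_mult"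
  shows "(\<Prod>i\<in>UNIV. g i) = g None * (\<Prod>i\<in>UNIV. g (Some i))"
  unfolding UNIV_option_eq by (subst prod.insert) (auto simp: prod.reindex)

lemma vcons_nth [simp]: "vcons t y $ None = t" "vcons t y $ Some i = y $ i"
  by (simp_all add: vcons_def)

lemma vcons_eq_iff: "x = vcons t y \<longleftrightarrow> x $ None = t \<and> (\<forall>i. x $ Some i = y $ i)"
  by (auto simp: vec_eq_iff vcons_def split: option.split)

lemma inner_vcons: "vcons t y \<bullet> vcons t' y' = t * t' + y \<bullet> y'"
  by (simp add: inner_vec_def sum_UNIV_option)

lemma vcons_measurable [measurable (raw)]:
  fixes g :: "'a \<Rightarrow> real ^ 'n"
  assumes [measurable]: "f \<in> borel_measurable M" "g \<in> borel_measurable M"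
  shows "(\<lambda>x. vcons (f x) (g x)) \<in> borel_measurable M"
proof -
  have "linear (\<lambda>p :: real \<times> (real ^ 'n). vcons (fst p) (snd p))"
    by (rule linearI) (auto simp: vec_eq_iff vcons_def split: option.split)
  then have "(\<lambda>p :: real \<times> (real ^ 'n). vcons (fst p) (snd p)) \<in> borel \<rightarrow>\<^sub>M borel"
    by (intro borel_measurable_continuous_onI linear_continuous_on linear_linear[THEN iffD2])
  from measurable_compose[OF borel_measurable_Pair[OF assms] this] show ?thesis by simp
qed

lemma lborel_vcons:
  "(lborel :: (real ^ ('n::finite) option) measure)
    = distr (lborel \<Otimes>\<^sub>M (lborel :: (real ^ 'n) measure)) borel (\<lambda>(t, y). vcons t y)"
proof (rule lborel_eqI)
  fix l u :: "real ^ ('n::finite) option"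
  assume "\<And>b. b \<in> Basis \<Longrightarrow> l \<bullet> b \<le> u \<bullet> b"
  then have le: "l $ i \<le> u $ i" for i
    by (metis axis_in_Basis_iff cart_eq_inner_axis insertI1 Basis_real_def)
  let ?t = "\<lambda>x. (\<chi> i. x $ Some i) :: real ^ 'n"
  have "(\<lambda>(t, y). vcons t y) -` box l u = box (l $ None) (u $ None) \<times> box (?t l) (?t u)"
    by (auto simp: mem_box_cart) (metis option.exhaust vcons_nth)+
  then have "emeasure (distr (lborel \<Otimes>\<^sub>M lborel) borel (\<lambda>(t, y). vcons t y)) (box l u)
      = emeasure (lborel \<Otimes>\<^sub>M lborel) (box (l $ None) (u $ None) \<times> box (?t l) (?t u))"
    by (subst emeasure_distr) (auto simp: space_pair_measure)
  also have "\<dots> = emeasure lborel (box (l $ None) (u $ None)) * emeasure lborel (box (?t l) (?t u))"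
    by (rule lborel.emeasure_pair_measure_Times) auto
  also have "\<dots> = ennreal ((u - l) $ None) * ennreal (\<Prod>i\<in>UNIV. (u - l) $ Some i)"
    using le by (simp add: emeasure_lborel_box_cart)
  also have "\<dots> = ennreal (\<Prod>i\<in>UNIV. (u - l) $ i)"
    using le by (simp add: prod_UNIV_option ennreal_mult prod_nonneg)
  finally show "emeasure (distr (lborel \<Otimes>\<^sub>M lborel) borel (\<lambda>(t, y). vcons t y)) (box l u)
      = (\<Prod>b\<in>Basis. (u - l) \<bullet> b)"
    by (simp add: prod_Basis_cart inner_axis)
qed simp

lemma nn_integral_vcons:
  fixes F :: "real ^ ('n::finite) option \<Rightarrow> ennreal"
  assumes [measurable]: "F \<in> borel_measurable borel"
  shows "(\<integral>\<^sup>+x. F x \<partial>lborel) = (\<integral>\<^sup>+t. \<integral>\<^sup>+y. F (vcons t y) \<partial>lborel \<partial>lborel)"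
  unfolding lborel_vcons
  by (subst nn_integral_distr) (simp_all add: case_prod_unfold lborel.nn_integral_fst[symmetric])

lemma integral_vcons:
  fixes f :: "real ^ ('n::finite) option \<Rightarrow> 'b::{banach, second_countable_topology}"
  assumes [measurable]: "f \<in> borel_measurable borel"
  shows "integrable (lborel \<Otimes>\<^sub>M lborel) (\<lambda>(t, y). f (vcons t y)) \<longleftrightarrow> integrable lborel f"
    and "(LINT x|lborel. f x) = integral\<^sup>L (lborel \<Otimes>\<^sub>M lborel) (\<lambda>p. f (vcons (fst p) (snd p)))"
  unfolding lborel_vcons
  by (subst integrable_distr_eq; simp add: case_prod_unfold) (subst integral_distr; simp add: case_prod_unfold)

text \<open>For fixed t \<noteq> 0 the substitution y = t v in the remaining coordinates has
  Jacobian |t|^(d-1). The slice t = 0, which the map collapses to the origin, is null.\<close>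

lemma lborel_projective:
  "(lborel :: (real ^ ('n::finite) option) measure)
    = distr (density (lborel \<Otimes>\<^sub>M (lborel :: (real ^ 'n) measure)) (\<lambda>p. ennreal (\<bar>fst p\<bar> ^ CARD('n))))
        borel (\<lambda>p. vcons (fst p) (fst p *\<^sub>R snd p))" (is "_ = distr (density ?P ?J) borel ?\<phi>")
proof (rule measure_eqI)
  fix A :: "(real ^ ('n::finite) option) set" assume "A \<in> sets lborel"
  then have [measurable]: "A \<in> sets borel" by simp
  have phi: "?\<phi> \<in> density ?P ?J \<rightarrow>\<^sub>M borel" by measurable
  have "emeasure lborel A = (\<integral>\<^sup>+x. indicator A x \<partial>lborel)" by simp
  also have "\<dots> = (\<integral>\<^sup>+t. \<integral>\<^sup>+y. indicator A (vcons t y) \<partial>lborel \<partial>(lborel :: real measure))"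
    by (rule nn_integral_vcons) simp
  also have "\<dots> = (\<integral>\<^sup>+t. \<integral>\<^sup>+y. ennreal (\<bar>t\<bar> ^ CARD('n)) * indicator A (vcons t (t *\<^sub>R y)) \<partial>lborel \<partial>lborel)"
  proof (rule nn_integral_cong_AE)
    show "AE t in lborel. (\<integral>\<^sup>+y. indicator A (vcons t y) \<partial>lborel)
        = (\<integral>\<^sup>+y. ennreal (\<bar>t\<bar> ^ CARD('n)) * indicator A (vcons t (t *\<^sub>R y)) \<partial>lborel)"
      using AE_lborel_singleton[of "0::real"]
    proof eventually_elim
      case (elim t)
      show ?case
        by (subst scales_lborel_nn_integral[OF scales_lborel_affine[OF elim, of 0]])
          (simp_all add: nn_integral_cmult)
    qed
  qed
  also have "\<dots> = (\<integral>\<^sup>+p. ?J p * indicator A (?\<phi> p) \<partial>?P)"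
    by (subst lborel.nn_integral_fst[symmetric]) simp_all
  also have "\<dots> = (\<integral>\<^sup>+x. indicator A x \<partial>distr (density ?P ?J) borel ?\<phi>)"
    by (subst nn_integral_distr[OF phi]) (simp_all add: nn_integral_density)
  finally show "emeasure lborel A = emeasure (distr (density ?P ?J) borel ?\<phi>) A" by simp
qed simp

lemma integral_projective:
  fixes f :: "real ^ ('n::finite) option \<Rightarrow> 'b::{banach, second_countable_topology}"
  assumes [measurable]: "f \<in> borel_measurable borel"
  shows "integrable (lborel \<Otimes>\<^sub>M lborel) (\<lambda>p. \<bar>fst p\<bar> ^ CARD('n) *\<^sub>R f (vcons (fst p) (fst p *\<^sub>R snd p)))
      \<longleftrightarrow> integrable lborel f"
    and "(LINT x|lborel. f x)
      = integral\<^sup>L (lborel \<Otimes>\<^sub>M lborel) (\<lambda>p. \<bar>fst p\<bar> ^ CARD('n) *\<^sub>R f (vcons (fst p) (fst p *\<^sub>R snd p)))"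
  unfolding lborel_projective
  by (subst integrable_distr_eq; simp add: integrable_density) (subst integral_distr; simp add: integral_density)

section \<open>The affine Radon transform and the shearlet matrices\<close>

lemma matrix_vector_mult_measurable [measurable (raw)]:
  fixes A :: "real ^ 'n ^ 'm"
  assumes "f \<in> borel_measurable M"
  shows "(\<lambda>x. A *v f x) \<in> borel_measurable M"
  using assms
  by (rule borel_measurable_continuous_on[rotated])
    (intro linear_continuous_on linear_linear[THEN iffD2] matrix_vector_mul_linear)

lemma affine_radon_measurable [measurable (raw)]:
  fixes f :: "real ^ ('n::finite) option \<Rightarrow> complex"
  assumes [measurable]: "f \<in> borel_measurable borel" "g \<in> borel_measurable M" "h \<in> borel_measurable M"
  shows "(\<lambda>x. affine_radon f (g x) (h x)) \<in> borel_measurable M"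
  unfolding affine_radon_def by measurable

text \<open>A translation of the first variable for each fixed \<open>y\<close>. It parametrises R^d
  through the hyperplanes x_1 + v \<cdot> y = t of the Radon transform.\<close>

lemma lborel_pair_shear:
  fixes v :: "'a::euclidean_space"
  shows "distr (lborel \<Otimes>\<^sub>M lborel) (lborel \<Otimes>\<^sub>M lborel) (\<lambda>p. (fst p - v \<bullet> snd p, snd p)) = lborel \<Otimes>\<^sub>M lborel"
    (is "distr ?P ?P ?T = ?P")
proof (rule measure_eqI)
  fix A assume "A \<in> sets (distr ?P ?P ?T)"
  then have A [measurable]: "A \<in> sets ?P" by simp
  have T: "?T \<in> ?P \<rightarrow>\<^sub>M ?P" by measurable
  have "emeasure (distr ?P ?P ?T) A = (\<integral>\<^sup>+p. indicator A p \<partial>distr ?P ?P ?T)"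
    by (rule nn_integral_indicator[symmetric]) (use A in simp)
  also have "\<dots> = (\<integral>\<^sup>+p. indicator A (?T p) \<partial>?P)" by (rule nn_integral_distr[OF T]) simp
  also have "\<dots> = (\<integral>\<^sup>+y. \<integral>\<^sup>+t. indicator A (t - v \<bullet> y, y) \<partial>lborel \<partial>lborel)"
    by (subst lborel_pair.nn_integral_snd[symmetric]) simp_all
  also have "\<dots> = (\<integral>\<^sup>+y. \<integral>\<^sup>+t. indicator A (t, y) \<partial>lborel \<partial>lborel)"
  proof (rule nn_integral_cong)
    fix y :: 'a
    show "(\<integral>\<^sup>+t. indicator A (t - v \<bullet> y, y) \<partial>lborel) = (\<integral>\<^sup>+t. indicator A (t, y) \<partial>lborel)"
      by (subst (2) scales_lborel_nn_integral[OF scales_lborel_translate[of "v \<bullet> y"]]) simp_all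
  qed
  also have "\<dots> = (\<integral>\<^sup>+p. indicator A p \<partial>?P)"
    by (subst lborel_pair.nn_integral_snd[symmetric]) simp_all
  also have "\<dots> = emeasure ?P A" by (rule nn_integral_indicator[OF A])
  finally show "emeasure (distr ?P ?P ?T) A = emeasure ?P A" .
qed simp

text \<open>On the hyperplane x_1 + v \<cdot> y = t the phase of frequency (\<tau>, \<tau>v) is the
  constant \<tau>t, so integrating over hyperplanes first gives the claim. It holds for every
  \<open>v\<close>, since (t, y) \<mapsto> f(t - v \<cdot> y, y) is integrable for each.\<close>

lemma fourier_slice:
  fixes f :: "real ^ ('n::finite) option \<Rightarrow> complex"
  assumes f: "integrable lborel f"
  shows "integrable lborel (affine_radon f v)"
    and "fourier_integral (affine_radon f v) \<tau> = fourier_integral f (vcons \<tau> (\<tau> *\<^sub>R v))"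
proof -
  let ?P = "lborel \<Otimes>\<^sub>M lborel :: (real \<times> (real ^ 'n)) measure"
  let ?T = "\<lambda>p :: real \<times> (real ^ 'n). (fst p - v \<bullet> snd p, snd p)"
  have [measurable]: "f \<in> borel_measurable borel" using f by auto
  have T: "?T \<in> ?P \<rightarrow>\<^sub>M ?P" by measurable
  have sh: "integrable ?P (\<lambda>p. h (?T p)) \<longleftrightarrow> integrable ?P h" "integral\<^sup>L ?P (\<lambda>p. h (?T p)) = integral\<^sup>L ?P h"
    if "h \<in> borel_measurable ?P" for h :: "_ \<Rightarrow> complex"
    using integrable_distr_eq[OF T that] integral_distr[OF T that] by (simp_all add: lborel_pair_shear)
  have "integrable ?P (\<lambda>p. f (vcons (fst p) (snd p)))"
    using f integral_vcons(1)[of f] by (simp add: case_prod_unfold)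
  then have int: "integrable ?P (\<lambda>(t, y). f (vcons (t - v \<bullet> y) y))"
    using sh(1)[of "\<lambda>p. f (vcons (fst p) (snd p))"] by (simp add: case_prod_unfold)
  show "integrable lborel (affine_radon f v)"
    using lborel_pair.integrable_fst[OF int] by (simp add: affine_radon_def[abs_def])
  let ?h = "\<lambda>p. f (vcons (fst p) (snd p)) * cis (- 2 * pi * (vcons \<tau> (\<tau> *\<^sub>R v) \<bullet> vcons (fst p) (snd p)))"
  have int': "integrable ?P (\<lambda>(t, y). f (vcons (t - v \<bullet> y) y) * cis (- 2 * pi * (\<tau> * t)))"
    using integrable_mult_cis[OF int, of "\<lambda>p. - 2 * pi * (\<tau> * fst p)"] by (simp add: case_prod_unfold)
  have "fourier_integral (affine_radon f v) \<tau>
      = (LINT t|lborel. LINT y|lborel. f (vcons (t - v \<bullet> y) y) * cis (- 2 * pi * (\<tau> * t)))"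
    by (simp add: fourier_integral_def affine_radon_def)
  also have "\<dots> = integral\<^sup>L ?P (\<lambda>(t, y). f (vcons (t - v \<bullet> y) y) * cis (- 2 * pi * (\<tau> * t)))"
    using lborel_pair.integral_fst'[OF int'] by simp
  also have "\<dots> = integral\<^sup>L ?P (\<lambda>p. ?h (?T p))"
    by (intro Bochner_Integration.integral_cong refl) (auto simp: inner_vcons algebra_simps)
  also have "\<dots> = integral\<^sup>L ?P ?h"
    by (rule sh(2)) measurable
  also have "\<dots> = fourier_integral f (vcons \<tau> (\<tau> *\<^sub>R v))"
    unfolding fourier_integral_def by (rule integral_vcons(2)[symmetric]) measurable
  finally show "fourier_integral (affine_radon f v) \<tau> = fourier_integral f (vcons \<tau> (\<tau> *\<^sub>R v))" .
qed

text \<open>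
  Plancherel gives \<open>\<integral>\<bar>\<tau>\<bar>\<^sup>d\<^sup>-\<^sup>1\<bar>\<F>f(\<tau>, \<tau>v)\<bar>\<^sup>2d\<tau> < \<infinity>\<close> for almost every \<open>v\<close>. The weight is at least 1 for
  \<open>\<bar>\<tau>\<bar> \<ge> 1\<close>, and \<open>\<F>f\<close> is bounded for \<open>\<bar>\<tau>\<bar> \<le> 1\<close>.
\<close>

lemma AE_square_integrable_affine_radon:
  fixes f :: "real ^ ('n::finite) option \<Rightarrow> complex"
  assumes f: "integrable lborel f" "square_integrable f"
  shows "AE v in lborel. square_integrable (affine_radon f v)"
proof -
  have [measurable]: "f \<in> borel_measurable borel" using f by auto
  define F where "F = fourier_integral f"
  have [measurable]: "F \<in> borel_measurable borel" unfolding F_def by measurable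
  have "integrable lborel (\<lambda>\<xi>. (cmod (F \<xi>))\<^sup>2)"
    using f square_integrable_fourier_integral_iff[OF f(1)] by (simp add: F_def square_integrable_def)
  then have "integrable (lborel \<Otimes>\<^sub>M lborel) (\<lambda>(\<tau>, v :: real ^ 'n). \<bar>\<tau>\<bar> ^ CARD('n) *\<^sub>R (cmod (F (vcons \<tau> (\<tau> *\<^sub>R v))))\<^sup>2)"
    using integral_projective(1)[of "\<lambda>\<xi>. (cmod (F \<xi>))\<^sup>2"] by (simp add: case_prod_unfold)
  from lborel_pair.AE_integrable_snd[OF this] show ?thesis
  proof eventually_elim
    case (elim v)
    define K where "K = (LINT x|lborel. cmod (f x))"
    have K: "cmod (F \<xi>) \<le> K" for \<xi>
      unfolding F_def K_def by (rule fourier_integral_bound[OF f(1)])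
    let ?H = "\<lambda>\<tau>. (cmod (F (vcons \<tau> (\<tau> *\<^sub>R v))))\<^sup>2"
    have "integrable lborel ?H"
    proof (rule Bochner_Integration.integrable_bound)
      show "integrable lborel (\<lambda>\<tau>. indicator {-1..1} \<tau> * K\<^sup>2 + \<bar>\<tau>\<bar> ^ CARD('n) *\<^sub>R ?H \<tau>)"
        using elim by (intro Bochner_Integration.integrable_add integrable_mult_left)
          (auto simp: integrable_indicator_iff)
      have "?H \<tau> \<le> indicator {-1..1} \<tau> * K\<^sup>2 + \<bar>\<tau>\<bar> ^ CARD('n) *\<^sub>R ?H \<tau>" for \<tau>
      proof (cases "\<tau> \<in> {-1..1}")
        case True
        have "?H \<tau> \<le> K\<^sup>2" by (intro power_mono K) simp
        then show ?thesis using True by (simp add: add_increasing2)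
      next
        case False
        then have "1 \<le> \<bar>\<tau>\<bar> ^ CARD('n)" by (intro one_le_power) auto
        then have "1 * ?H \<tau> \<le> \<bar>\<tau>\<bar> ^ CARD('n) * ?H \<tau>" by (rule mult_right_mono) simp
        then show ?thesis using False by simp
      qed
      then show "AE \<tau> in lborel. norm (?H \<tau>) \<le> norm (indicator {-1..1} \<tau> * K\<^sup>2 + \<bar>\<tau>\<bar> ^ CARD('n) *\<^sub>R ?H \<tau>)"
        by (auto intro: order_trans)
    qed simp
    then have "square_integrable (fourier_integral (affine_radon f v))"
      unfolding square_integrable_def fourier_slice(2)[OF f(1)] F_def[symmetric] by simp
    then show ?case
      using square_integrable_fourier_integral_iff[OF fourier_slice(1)[OF f(1)]] by blast
  qed
qed

section \<open>Determinant and transpose of the shearlet matrices\<close>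

lemma Lambda_matrix_mult:
  "(Lambda_matrix lam a *v x) $ j = \<bar>a\<bar> powr (lam $ j) * x $ j"
  "(x v* Lambda_matrix lam a) $ j = \<bar>a\<bar> powr (lam $ j) * x $ j"
  "(M ** Lambda_matrix lam a) $ i $ j = \<bar>a\<bar> powr (lam $ j) * M $ i $ j"
  by (simp_all add: matrix_vector_mult_def vector_matrix_mult_def matrix_matrix_mult_def Lambda_matrix_def
      if_distrib[of "\<lambda>x. x * _"] if_distrib[of "\<lambda>x. _ * x"] cong: if_cong)

lemma det_Lambda_matrix:
  fixes lam :: "real ^ 'n"
  assumes "a \<noteq> 0"
  shows "det (Lambda_matrix lam a) = \<bar>a\<bar> powr lambda_D lam"
proof -
  have "det (Lambda_matrix lam a) = (\<Prod>i\<in>UNIV. \<bar>a\<bar> powr (lam $ i))"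
    by (subst det_diagonal) (auto simp: Lambda_matrix_def)
  then show ?thesis using assms by (simp add: lambda_D_def powr_sum)
qed

text \<open>The unipotent factor has determinant 1; the diagonal one contributes |a| once per
  coordinate of R^d, and the powers from \<Lambda>(a).\<close>

lemma abs_det_shearlet_matrix:
  fixes lam :: "real ^ ('n::{finite,linorder})"
  assumes "block_matrix (- s) (B s) \<in> unipotent_upper_triangular" and a: "a \<noteq> 0"
  shows "\<bar>det (shearlet_matrix B lam s a)\<bar> = \<bar>a\<bar> powr (real CARD('n option) + lambda_D lam)"
proof -
  let ?D = "a *\<^sub>R block_matrix 0 (Lambda_matrix lam a)"
  have "det ?D = (\<Prod>i\<in>UNIV. ?D $ i $ i)"
    by (rule det_diagonal) (auto simp: block_matrix_def vcons_def Lambda_matrix_def split: option.split)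
  also have "\<dots> = a * (\<Prod>i\<in>(UNIV :: 'n set). a * \<bar>a\<bar> powr (lam $ i))"
    by (simp add: prod_UNIV_option block_matrix_def Lambda_matrix_def)
  also have "\<dots> = a * a ^ CARD('n) * \<bar>a\<bar> powr lambda_D lam"
    using a by (simp add: prod.distrib lambda_D_def powr_sum)
  finally have "\<bar>det ?D\<bar> = \<bar>a\<bar> ^ Suc CARD('n) * \<bar>a\<bar> powr lambda_D lam"
    by (simp add: abs_mult power_abs)
  then show ?thesis
    using a by (simp add: shearlet_matrix_eq det_mul det_unipotent_upper_triangular[OF assms(1)]
        powr_add powr_realpow[symmetric] card_UNIV_option)
qed

lemma transpose_mult_nth: "(transpose A *v x) $ j = (\<Sum>i\<in>UNIV. A $ i $ j * x $ i)"
  by (simp only: matrix_vector_mult_def transpose_def vec_lambda_beta)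

text \<open>All the last coordinates carry the factor \<open>a * \<tau>\<close> that is the new
  first one, so the new direction does not depend on \<open>\<tau>\<close>. This is what separates
  the variables.\<close>

lemma transpose_shearlet_matrix_vcons:
  "transpose (shearlet_matrix B lam s a) *v vcons \<tau> (\<tau> *\<^sub>R v)
    = vcons (a * \<tau>) ((a * \<tau>) *\<^sub>R (Lambda_matrix lam a *v (transpose (B s) *v v - s)))"
proof -
  have "(transpose (shearlet_matrix B lam s a) *v vcons \<tau> (\<tau> *\<^sub>R v)) $ None = a * \<tau>"
    unfolding transpose_mult_nth sum_UNIV_option by (simp add: shearlet_matrix_def block_matrix_def)
  moreover have "(transpose (shearlet_matrix B lam s a) *v vcons \<tau> (\<tau> *\<^sub>R v)) $ Some j
      = ((a * \<tau>) *\<^sub>R (Lambda_matrix lam a *v (transpose (B s) *v v - s))) $ j" for j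
  proof -
    have "(transpose (shearlet_matrix B lam s a) *v vcons \<tau> (\<tau> *\<^sub>R v)) $ Some j
        = - (a * (\<bar>a\<bar> powr (lam $ j) * s $ j)) * \<tau> + (\<Sum>i\<in>UNIV. (a * (\<bar>a\<bar> powr (lam $ j) * B s $ i $ j)) * (\<tau> * v $ i))"
      unfolding transpose_mult_nth sum_UNIV_option
      by (simp add: shearlet_matrix_def block_matrix_def Lambda_matrix_mult mult_ac)
    also have "(\<Sum>i\<in>UNIV. (a * (\<bar>a\<bar> powr (lam $ j) * B s $ i $ j)) * (\<tau> * v $ i))
        = a * \<tau> * \<bar>a\<bar> powr (lam $ j) * (transpose (B s) *v v) $ j"
      unfolding transpose_mult_nth sum_distrib_left by (simp add: mult_ac)
    finally show ?thesis by (simp add: Lambda_matrix_mult algebra_simps)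
  qed
  ultimately show ?thesis by (simp add: vcons_eq_iff)
qed

section \<open>Both transforms on the frequency side\<close>

text \<open>The wavelet is a pullback under the inverse of a translated dilation, and a dilation of
  the line is its own transpose; Parseval does the rest.\<close>

lemma wavelet_transform_eq:
  assumes g: "integrable lborel g" "square_integrable g" and h: "square_integrable h" and a: "a \<noteq> 0"
  shows "wavelet_transform h g \<beta> a = (LINT \<tau>|lborel. fourier_integral g \<tau> *
    cnj (of_real (\<bar>a\<bar> powr (- 1 / 2)) * of_real \<bar>a\<bar> * cis (- 2 * pi * (\<tau> * \<beta>)) * fourier h (a * \<tau>)))"
proof -
  have sc: "scales_lborel (\<lambda>x::real. a * x) \<bar>a\<bar>"
    using scales_lborel_affine[OF a, of "0::real"] by simp
  have S: "(\<lambda>x::real. x / a) \<in> borel \<rightarrow>\<^sub>M borel" by measurable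
  note ft = is_fourier_transform_linear_pullback[OF is_fourier_transform_fourier[OF h] h sc S, of "\<lambda>x. a * x"
      "of_real (\<bar>a\<bar> powr (- 1 / 2))" \<beta>]
  have "square_integrable (wavelet_rep \<beta> a h)"
    "is_fourier_transform (wavelet_rep \<beta> a h)
      (\<lambda>\<tau>. of_real (\<bar>a\<bar> powr (- 1 / 2)) * of_real \<bar>a\<bar> * cis (- 2 * pi * (\<tau> \<bullet> \<beta>)) * fourier h (a * \<tau>))"
    unfolding wavelet_rep_def[abs_def] by (rule ft; use a sc in \<open>simp add: mult_ac\<close>)+
  from parseval_is_fourier_transform[OF g this] show ?thesis
    by (simp add: wavelet_transform_def l2_inner_def)
qed

text \<open>As for the wavelet transform, with the transposed matrix acting on frequencies.
  Integrability of \<open>G\<close> is what Fubini in projective coordinates requires.\<close>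

lemma shearlet_transform_eq:
  fixes B :: "real ^ ('n::{finite,linorder}) \<Rightarrow> real ^ ('n::{finite,linorder}) ^ ('n::{finite,linorder})"
    and b :: "real ^ 'n option"
  assumes f: "integrable lborel f" "square_integrable f" and psi: "square_integrable \<psi>"
    and det: "det (shearlet_matrix B lam s a) \<noteq> 0"
  defines "G \<equiv> \<lambda>\<xi>. fourier_integral f \<xi> * cnj (of_real (\<bar>a\<bar> powr (- (real CARD('n option) + lambda_D lam) / 2))
      * of_real \<bar>det (shearlet_matrix B lam s a)\<bar> * cis (- 2 * pi * (\<xi> \<bullet> b))
      * fourier \<psi> (transpose (shearlet_matrix B lam s a) *v \<xi>))"
  shows "integrable lborel G" and "shearlet_transform B lam \<psi> f b s a = (LINT \<xi>|lborel. G \<xi>)"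
proof -
  let ?h = "shearlet_matrix B lam s a"
  have inv: "invertible ?h" using det by (simp add: invertible_det_nz)
  have inv_left: "matrix_inv ?h ** ?h = mat 1"
    using inv unfolding invertible_def matrix_inv_def by (rule someI2_ex) blast
  have S: "(\<lambda>x. matrix_inv ?h *v x) \<in> borel \<rightarrow>\<^sub>M borel" by measurable
  have ST: "matrix_inv ?h *v (?h *v x) = x" for x
    using inv_left by (simp add: matrix_vector_mul_assoc)
  have adj: "\<xi> \<bullet> (?h *v x) = (transpose ?h *v \<xi>) \<bullet> x" for \<xi> x
    by (simp add: dot_lmul_matrix)
  have T': "scales_lborel ((*v) (transpose ?h)) \<bar>det ?h\<bar>"
    using scales_lborel_matrix[of "transpose ?h"] det unfolding det_transpose by blast
  note ft = is_fourier_transform_linear_pullback[OF is_fourier_transform_fourier[OF psi] psi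
      scales_lborel_matrix[OF det] S ST adj T']
  have rep: "square_integrable (shearlet_rep B lam b s a \<psi>)"
    "is_fourier_transform (shearlet_rep B lam b s a \<psi>)
      (\<lambda>\<xi>. of_real (\<bar>a\<bar> powr (- (real CARD('n option) + lambda_D lam) / 2))
      * of_real \<bar>det ?h\<bar> * cis (- 2 * pi * (\<xi> \<bullet> b)) * fourier \<psi> (transpose ?h *v \<xi>))"
    unfolding shearlet_rep_def[abs_def] by (rule ft)+
  show "integrable lborel G"
    unfolding G_def using f rep(2) square_integrable_fourier_integral_iff[OF f(1)]
    by (intro integrable_square_mult square_integrable_cnj) (auto simp: is_fourier_transform_def)
  show "shearlet_transform B lam \<psi> f b s a = (LINT \<xi>|lborel. G \<xi>)"
    using parseval_is_fourier_transform[OF f rep] by (simp add: shearlet_transform_def l2_inner_def G_def)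
qed

theorem corollary12:
  fixes B :: "real ^ ('n::{finite,linorder}) \<Rightarrow> real ^ ('n::{finite,linorder}) ^ ('n::{finite,linorder})"
    and lam :: "real ^ ('n::{finite,linorder})"
    and H :: "(real ^ ('n::{finite,linorder}) option ^ ('n::{finite,linorder}) option) set"
    and \<psi> :: "real ^ ('n::{finite,linorder}) option \<Rightarrow> complex"
    and \<psi>\<^sub>1 \<chi>\<^sub>1 :: "real \<Rightarrow> complex"
    and \<psi>\<^sub>2 \<phi>\<^sub>2 :: "real ^ ('n::{finite,linorder}) \<Rightarrow> complex"
  assumes "shearlet_dilation_group B lam H"
    and "square_integrable \<psi>"
    and "square_integrable \<psi>\<^sub>1"
    and "square_integrable \<psi>\<^sub>2"
    and "AE (\<tau>, v) in lborel.
           fourier \<psi> (vcons \<tau> (\<tau> *\<^sub>R v)) = fourier \<psi>\<^sub>1 \<tau> * fourier \<psi>\<^sub>2 v"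
    and "(\<integral>\<^sup>+\<tau>. ennreal (\<bar>\<tau>\<bar> ^ CARD('n) * (cmod (fourier \<psi>\<^sub>1 \<tau>))\<^sup>2) \<partial>lborel) < \<infinity>"
    and "0 < (\<integral>\<^sup>+\<tau>. ennreal ((cmod (fourier \<psi>\<^sub>1 \<tau>))\<^sup>2 / \<bar>\<tau>\<bar>) \<partial>lborel)"
    and "(\<integral>\<^sup>+\<tau>. ennreal ((cmod (fourier \<psi>\<^sub>1 \<tau>))\<^sup>2 / \<bar>\<tau>\<bar>) \<partial>lborel) < \<infinity>"
    and "(\<integral>\<^sup>+\<tau>. ennreal (\<bar>\<tau>\<bar> ^ (2 * CARD('n)) * (cmod (fourier \<psi>\<^sub>1 \<tau>))\<^sup>2) \<partial>lborel) < \<infinity>"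
    and "square_integrable \<phi>\<^sub>2"
    and "AE v in lborel. \<phi>\<^sub>2 v = fourier \<psi>\<^sub>2 v"
    and "square_integrable \<chi>\<^sub>1"
    and "AE \<tau> in lborel. fourier \<chi>\<^sub>1 \<tau> = of_real (\<bar>\<tau>\<bar> ^ CARD('n)) * fourier \<psi>\<^sub>1 \<tau>"
  shows "\<forall>f :: real ^ 'n option \<Rightarrow> complex. integrable lborel f \<and> square_integrable f \<longrightarrow>
           (\<forall>b s a. a \<noteq> 0 \<longrightarrow>
              shearlet_transform B lam \<psi> f b s a =
                of_real (\<bar>a\<bar> powr (- real CARD('n) / 2)) *
                V_transform B lam \<phi>\<^sub>2
                  (\<lambda>v. wavelet_transform \<chi>\<^sub>1 (affine_radon f v) (vcons 1 v \<bullet> b) a) s a)"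
proof (intro allI impI, elim conjE)
  fix f :: "real ^ 'n option \<Rightarrow> complex" and b :: "real ^ 'n option" and s :: "(real, 'n) vec" and a :: real
  assume f: "integrable lborel f" "square_integrable f" and a: "a \<noteq> 0"
  define F where "F = fourier_integral f"
  define \<Psi> where "\<Psi> = fourier \<psi>"
  define X where "X = fourier \<chi>\<^sub>1"
  define w where "w v = Lambda_matrix lam a *v (transpose (B s) *v v - s)" for v
  define J where "J = \<bar>a\<bar> powr (real CARD('n option) + lambda_D lam)"
  define c where "c = \<bar>a\<bar> powr (- (real CARD('n option) + lambda_D lam) / 2)"
  let ?n = "CARD('n)" and ?h = "shearlet_matrix B lam s a"
  have f_meas [measurable]: "f \<in> borel_measurable borel" using f by auto
  have [measurable]: "F \<in> borel_measurable borel" unfolding F_def by measurable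
  have "square_integrable \<Psi>" "square_integrable X"
    using is_fourier_transform_fourier[OF assms(2)] is_fourier_transform_fourier[OF assms(12)]
    by (simp_all add: \<Psi>_def X_def is_fourier_transform_def)
  note [measurable] = this[THEN square_integrable_measurable]
    square_integrable_measurable[OF assms(10)] square_integrable_measurable[OF assms(12)]
  have [measurable]: "w \<in> borel_measurable borel" unfolding w_def[abs_def] by measurable
  have uni: "B s \<in> unipotent_upper_triangular" "block_matrix (- s) (B s) \<in> unipotent_upper_triangular"
    using assms(1) by (auto simp: shearlet_dilation_group_def shear_group_def)
  have J: "\<bar>det ?h\<bar> = J"
    unfolding J_def by (rule abs_det_shearlet_matrix) (fact uni a)+
  have Jpos: "J > 0" unfolding J_def using a by simp
  then have det: "det ?h \<noteq> 0" using J by auto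
  \<comment> \<open>\<open>w\<close> is affine, and its linear part has determinant |a|^lambda_D.
    The factor stays unnamed because the fact serves to pull back null sets.\<close>
  have w_scales: "\<exists>K. scales_lborel w K"
  proof -
    let ?M = "Lambda_matrix lam a ** transpose (B s)"
    have "det ?M \<noteq> 0"
      using a by (simp add: det_mul det_Lambda_matrix det_unipotent_upper_triangular[OF uni(1)])
    from scales_lborel_comp[OF scales_lborel_translate[of "Lambda_matrix lam a *v s"] scales_lborel_matrix[OF this]]
    have "scales_lborel (\<lambda>v. ?M *v v - Lambda_matrix lam a *v s) (1 * \<bar>det ?M\<bar>)" .
    moreover have "w = (\<lambda>v. ?M *v v - Lambda_matrix lam a *v s)"
      by (simp add: w_def fun_eq_iff matrix_vector_mult_diff_distrib matrix_vector_mul_assoc del: transpose_matrix_vector)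
    ultimately show ?thesis by blast
  qed
  \<comment> \<open>Multiplying by |\<tau>|^(d-1) brings in \<open>\<chi>\<^sub>1\<close> without
    dividing at \<tau> = 0.\<close>
  define Q where "Q \<tau> v \<longleftrightarrow> of_real (\<bar>\<tau>\<bar> ^ ?n) * \<Psi> (vcons \<tau> (\<tau> *\<^sub>R v)) = X \<tau> * \<phi>\<^sub>2 v" for \<tau> v
  have Q_sets: "{p \<in> space (lborel \<Otimes>\<^sub>M lborel). Q (a * fst p) (w (snd p))} \<in> sets (lborel \<Otimes>\<^sub>M lborel)"
    unfolding Q_def by measurable
  \<comment> \<open>Here \<open>\<tau>\<close> is outermost: the identity for
    \<open>fourier \<chi>\<^sub>1\<close> concerns it alone, and for each good \<open>\<tau>\<close>
    a null set of \<open>v\<close> is lost.\<close>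
  have AE_Q: "AE \<tau> in lborel. AE v in lborel. Q \<tau> v"
  proof -
    have "AE p in lborel \<Otimes>\<^sub>M lborel. \<Psi> (vcons (fst p) (fst p *\<^sub>R snd p)) = fourier \<psi>\<^sub>1 (fst p) * fourier \<psi>\<^sub>2 (snd p)"
      using assms(5) unfolding \<Psi>_def lborel_prod by (simp add: case_prod_unfold)
    from lborel_pair.AE_pair[OF this] assms(13)
    show ?thesis
    proof eventually_elim
      case (elim \<tau>)
      from elim(1) assms(11) show ?case
        by eventually_elim (use elim(2) in \<open>simp add: Q_def X_def\<close>)
    qed
  qed
  have "AE \<tau> in lborel. AE v in lborel. Q (a * \<tau>) (w v)"
  proof -
    have "AE \<tau> in lborel. AE v in lborel. Q (0 + a *\<^sub>R \<tau>) v"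
      by (rule scales_lborel_AE[OF scales_lborel_affine[OF a] AE_Q])
    then show ?thesis
    proof eventually_elim
      case (elim \<tau>)
      obtain K where "scales_lborel w K" using w_scales by blast
      from scales_lborel_AE[OF this elim] show ?case by simp
    qed
  qed
  \<comment> \<open>The order is exchanged because the integral over \<open>v\<close> will be the
    outer one.\<close>
  then have Q: "AE v in lborel. AE \<tau> in lborel. Q (a * \<tau>) (w v)"
    by (rule lborel_pair.AE_commute[THEN iffD1, rotated]) (rule Q_sets)

  define G where "G = (\<lambda>\<xi>. F \<xi> * cnj (of_real c * of_real J * cis (- 2 * pi * (\<xi> \<bullet> b)) * \<Psi> (transpose ?h *v \<xi>)))"
  have [measurable]: "G \<in> borel_measurable borel"
    unfolding G_def by measurable
  have G: "integrable lborel G" "shearlet_transform B lam \<psi> f b s a = (LINT \<xi>|lborel. G \<xi>)"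
    using shearlet_transform_eq[OF f assms(2) det, of b] by (simp_all add: G_def F_def \<Psi>_def c_def J)
  let ?g = "\<lambda>\<tau> v. \<bar>\<tau>\<bar> ^ ?n *\<^sub>R G (vcons \<tau> (\<tau> *\<^sub>R v))"
  have g: "integrable (lborel \<Otimes>\<^sub>M lborel) (\<lambda>(\<tau>, v). ?g \<tau> v)"
    using integral_projective(1)[of G] G(1) by (simp add: case_prod_unfold)
  let ?W = "\<lambda>v. wavelet_transform \<chi>\<^sub>1 (affine_radon f v) (vcons 1 v \<bullet> b) a"
  let ?C = "\<bar>a\<bar> powr (- real ?n / 2)"
  have "shearlet_transform B lam \<psi> f b s a = (LINT v|lborel. LINT \<tau>|lborel. ?g \<tau> v)"
    using lborel_pair.integral_snd[OF g] by (simp add: G(2) integral_projective(2)[of G] case_prod_unfold)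
  also have "\<dots> = (LINT v|lborel. of_real ?C * (?W v * cnj (V_rep B lam s a \<phi>\<^sub>2 v)))"
  proof (rule integral_cong_AE)
    show "(\<lambda>v. LINT \<tau>|lborel. ?g \<tau> v) \<in> borel_measurable lborel" by measurable
    show "(\<lambda>v. of_real ?C * (?W v * cnj (V_rep B lam s a \<phi>\<^sub>2 v))) \<in> borel_measurable lborel"
      unfolding wavelet_transform_def l2_inner_def wavelet_rep_def V_rep_def by measurable
    show "AE v in lborel. (LINT \<tau>|lborel. ?g \<tau> v) = of_real ?C * (?W v * cnj (V_rep B lam s a \<phi>\<^sub>2 v))"
      \<comment> \<open>A good \<open>v\<close> is one where the factorisation holds for almost
        every \<open>\<tau>\<close> and the Radon slice is in L2, so that Parseval on the line
        applies.\<close>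
      using Q AE_square_integrable_affine_radon[OF f]
    proof eventually_elim
      case (elim v)
      let ?H = "\<lambda>\<tau>. F (vcons \<tau> (\<tau> *\<^sub>R v)) * cnj (of_real (\<bar>a\<bar> powr (- 1 / 2)) * of_real \<bar>a\<bar>
        * cis (- 2 * pi * (\<tau> * (vcons 1 v \<bullet> b))) * X (a * \<tau>))"
      \<comment> \<open>The part of the integrand that is constant in \<open>\<tau>\<close>.\<close>
      define d where "d = of_real ?C * cnj (V_rep B lam s a \<phi>\<^sub>2 v)"
      \<comment> \<open>The exponent -(d + lambda_D)/2 + (d + lambda_D) splits as (d-1) - (d-1)/2 +
        (-1/2 + 1) + lambda_D/2: the factor completing |\<tau>|^(d-1) to |a\<tau>|^(d-1) in
        \<open>Q\<close>, the constant of the theorem, the wavelet normalisation with its Jacobian,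
        and the normalisation of \<open>V_rep\<close>.\<close>
      have const: "c * J = \<bar>a\<bar> ^ ?n * (?C * (\<bar>a\<bar> powr (- 1 / 2) * \<bar>a\<bar>) * \<bar>a\<bar> powr (lambda_D lam / 2))"
      proof -
        have "c * J = \<bar>a\<bar> powr ((real ?n + 1 + lambda_D lam) / 2)"
          unfolding c_def J_def powr_add[symmetric] by (simp add: card_UNIV_option field_simps)
        also have "\<dots> = \<bar>a\<bar> powr real ?n * (\<bar>a\<bar> powr (- real ?n / 2) * (\<bar>a\<bar> powr (- 1 / 2) * \<bar>a\<bar> powr 1)
            * \<bar>a\<bar> powr (lambda_D lam / 2))"
          unfolding powr_add[symmetric] by (simp add: field_simps)
        finally show ?thesis using a by (simp add: powr_realpow)
      qed
      have eq: "?g \<tau> v = ?H \<tau> * d" if Q: "Q (a * \<tau>) (w v)" for \<tau>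
      proof -
        let ?\<xi> = "vcons \<tau> (\<tau> *\<^sub>R v)"
        \<comment> \<open>Writing (\<tau>, \<tau>v) = \<tau> n(v) makes the phase that of a wavelet
          translated by n(v) \<cdot> b.\<close>
        have xi: "?\<xi> = \<tau> *\<^sub>R vcons 1 v"
          by (simp add: vec_eq_iff vcons_def split: option.split)
        have q: "of_real (\<bar>a\<bar> ^ ?n) * (of_real (\<bar>\<tau>\<bar> ^ ?n) * \<Psi> (transpose ?h *v ?\<xi>)) = X (a * \<tau>) * \<phi>\<^sub>2 (w v)"
          using Q unfolding transpose_shearlet_matrix_vcons Q_def
          by (simp add: w_def abs_mult power_mult_distrib mult_ac)
        have "?g \<tau> v = F ?\<xi> * cnj (of_real (c * J) * cis (- 2 * pi * (?\<xi> \<bullet> b)) * (of_real (\<bar>\<tau>\<bar> ^ ?n) * \<Psi> (transpose ?h *v ?\<xi>)))"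
          unfolding G_def by (simp add: scaleR_conv_of_real mult_ac)
        also have "\<dots> = F ?\<xi> * cnj (of_real (?C * (\<bar>a\<bar> powr (- 1 / 2) * \<bar>a\<bar>) * \<bar>a\<bar> powr (lambda_D lam / 2))
            * cis (- 2 * pi * (?\<xi> \<bullet> b)) * (of_real (\<bar>a\<bar> ^ ?n) * (of_real (\<bar>\<tau>\<bar> ^ ?n) * \<Psi> (transpose ?h *v ?\<xi>))))"
          unfolding const by (simp add: mult_ac)
        also have "\<dots> = ?H \<tau> * d"
          unfolding q unfolding d_def V_rep_def xi inner_scaleR_left by (simp add: w_def mult_ac)
        finally show ?thesis .
      qed
      have "(LINT \<tau>|lborel. ?g \<tau> v) = (LINT \<tau>|lborel. ?H \<tau> * d)"
      proof (rule integral_cong_AE)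
        show "AE \<tau> in lborel. ?g \<tau> v = ?H \<tau> * d"
          using elim(1) by eventually_elim (rule eq)
      qed measurable
      also have "\<dots> = (LINT \<tau>|lborel. ?H \<tau>) * d" by simp
      also have "(LINT \<tau>|lborel. ?H \<tau>) = ?W v"
        unfolding wavelet_transform_eq[OF fourier_slice(1)[OF f(1)] elim(2) assms(12) a] fourier_slice(2)[OF f(1)]
        by (simp add: F_def X_def)
      finally show ?case by (simp add: d_def mult_ac)
    qed
  qed
  also have "\<dots> = of_real ?C * V_transform B lam \<phi>\<^sub>2 ?W s a"
    by (simp add: V_transform_def l2_inner_def)
  finally show "shearlet_transform B lam \<psi> f b s a = of_real ?C * V_transform B lam \<phi>\<^sub>2 ?W s a" .
qed

end
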